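(* Let $n\ge 2$ and $m$ be integers with $2\le m\le n$. Then the graph $\mathcal{P}^{\mathrm{all}}_n$ admits a $2(m-2)!$-rainbow cycle. In particular, taking $m=n$, there is a balanced transposition Gray code for the permutations of $[n]$, i.e. a cyclic listing of all $n!$ permutations of $[n]$ in which consecutive permutations (including the last and the first) differ by a transposition and every transposition $(i,j)$, $1\le i<j\le n$, is used exactly $2(n-2)!$ times.
   Context: $S_n$ is the set of permutations of $[n]=\{1,\dots,n\}$, written in one-line notation $\pi_1\pi_2\cdots\pi_n$. For distinct $i,j\in[n]$, applying the transposition $(i,j)$ to $\pi$ means interchanging the entries $i$ and $j$ in the one-line notation (e.g. $213\to 231$ under $(1,3)$). $\mathcal{P}^{\mathrm{all}}_n$ is the graph with vertex set $S_n$ in which two permutations are adjacent if they differ by some transposition; the edge is colored by that transposition. An $r$-rainbow cycle is a cyclic sequence $\pi^{(1)},\dots,\pi^{(k)}$ of pairwise distinct permutations ($k\ge 2$) such that consecutive ones, including $\pi^{(k)}$ and $\pi^{(1)}$, differ by a transposition, and each of the $\binom{n}{2}$ transpositions is used in exactly $r$ of these $k$ steps. *)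

theory Defs
  imports "HOL-Combinatorics.Permutations"
begin

definition Perms :: "nat \<Rightarrow> (nat \<Rightarrow> nat) set" where
  "Perms n = {\<pi>. \<pi> permutes {1..n}}"

text \<open>The transposition \<open>(i, j)\<close> is represented by the pair with \<open>i < j\<close>.\<close>

definition transpositions :: "nat \<Rightarrow> (nat \<times> nat) set" where
  "transpositions n = {(i, j). 1 \<le> i \<and> i < j \<and> j \<le> n}"

text \<open>The one-line notation of \<open>\<pi>\<close> is \<open>\<pi> 1 \<pi> 2 \<dots> \<pi> n\<close>, so interchanging the \<^emph>\<open>entries\<close>
  (values) \<open>i\<close> and \<open>j\<close> is composition with the transposition on the left;
  composition on the right would interchange the entries at \<^emph>\<open>positions\<close> \<open>i\<close> and \<open>j\<close>.\<close>

definition apply_transposition :: "nat \<times> nat \<Rightarrow> (nat \<Rightarrow> nat) \<Rightarrow> nat \<Rightarrow> nat" where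
  "apply_transposition t \<pi> = transpose (fst t) (snd t) \<circ> \<pi>"

text \<open>The edge-colored graph with vertex set \<open>Perms n\<close>: the permutations \<open>\<pi>\<close> and \<open>\<sigma>\<close> are joined
  by an edge of color \<open>t\<close>. The color of an edge is unique, see \<open>edge_color_unique\<close> below.\<close>

definition colored_edge :: "nat \<Rightarrow> nat \<times> nat \<Rightarrow> (nat \<Rightarrow> nat) \<Rightarrow> (nat \<Rightarrow> nat) \<Rightarrow> bool" where
  "colored_edge n t \<pi> \<sigma> \<longleftrightarrow>
     \<pi> \<in> Perms n \<and> \<sigma> \<in> Perms n \<and> t \<in> transpositions n \<and> \<sigma> = apply_transposition t \<pi>"

definition adjacent :: "nat \<Rightarrow> (nat \<Rightarrow> nat) \<Rightarrow> (nat \<Rightarrow> nat) \<Rightarrow> bool" where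
  "adjacent n \<pi> \<sigma> \<longleftrightarrow> (\<exists>t. colored_edge n t \<pi> \<sigma>)"

definition cyc_next :: "'a list \<Rightarrow> nat \<Rightarrow> 'a" where
  "cyc_next xs a = xs ! (Suc a mod length xs)"

text \<open>Steps are counted by their starting index, so a cyclic sequence of length 2
  has two steps, going back and forth along the same edge.\<close>

definition uses :: "nat \<Rightarrow> nat \<times> nat \<Rightarrow> (nat \<Rightarrow> nat) list \<Rightarrow> nat" where
  "uses n t xs = card {a. a < length xs \<and> colored_edge n t (xs ! a) (cyc_next xs a)}"

definition rainbow_cycle :: "nat \<Rightarrow> nat \<Rightarrow> (nat \<Rightarrow> nat) list \<Rightarrow> bool" where
  "rainbow_cycle n r xs \<longleftrightarrow>
     2 \<le> length xs \<and> set xs \<subseteq> Perms n \<and> distinct xs \<and>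
     (\<forall>a < length xs. adjacent n (xs ! a) (cyc_next xs a)) \<and>
     (\<forall>t \<in> transpositions n. uses n t xs = r)"

definition balanced_transposition_gray_code :: "nat \<Rightarrow> (nat \<Rightarrow> nat) list \<Rightarrow> bool" where
  "balanced_transposition_gray_code n xs \<longleftrightarrow>
     length xs = fact n \<and> set xs = Perms n \<and> distinct xs \<and>
     (\<forall>a < length xs. adjacent n (xs ! a) (cyc_next xs a)) \<and>
     (\<forall>t \<in> transpositions n. uses n t xs = 2 * fact (n - 2))"

lemma edge_color_unique:
  assumes "colored_edge n s \<pi> \<sigma>" "colored_edge n t \<pi> \<sigma>"
  shows "s = t"
proof -
  have surj: "surj \<pi>"
    using assms(1) permutes_surj unfolding colored_edge_def Perms_def by blast
  have "transpose (fst s) (snd s) \<circ> \<pi> = transpose (fst t) (snd t) \<circ> \<pi>"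
    using assms by (simp add: colored_edge_def apply_transposition_def)
  then have eq: "transpose (fst s) (snd s) x = transpose (fst t) (snd t) x" for x
    using surj by (metis comp_apply surjD)
  have lt: "fst s < snd s" "fst t < snd t"
    using assms by (auto simp: colored_edge_def transpositions_def)
  show ?thesis
    using eq[of "fst s"] eq[of "snd s"] lt
    by (auto simp: transpose_def prod_eq_iff split: if_splits)
qed

lemma adjacent_sym: "adjacent n \<pi> \<sigma> \<Longrightarrow> adjacent n \<sigma> \<pi>"
  unfolding adjacent_def colored_edge_def apply_transposition_def
  by (metis comp_assoc comp_id id_comp transpose_comp_involutory)

end

(* Fix the cyclic shift rot of the values 1, ..., n. Permutations with pi(n) = n represent the cosets
   of <rot>, and every word fixing n belongs to a tile: the words obtained from one word tau fixing 1
   and n by moving the value 1 through the positions 1, ..., n - 1. A tile is a path that uses each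
   transposition (1, d), 2 <= d < n, once. Summed over all n rotations, a tile together with one
   transposition of cyclically adjacent values therefore uses every transposition exactly twice.

   Let N = (m - 2)!. If N = 1, a swap of n and 1 leads from the end of a tile to the start of the next
   rotated tile, and the n rotated tiles form the cycle. If N is even, take a Hamiltonian cycle on the
   permutations of {2, ..., m - 1} by swaps of adjacent values. Traversing the N tiles alternately
   forwards and backwards gives a closed walk in one coset, with the right number of uses after
   rotation, hence n disjoint cycles. Consecutive ones are merged by exchanging two edges of the same
   color for two parallel edges (n, 1), and each exchange trades adjacent swaps for adjacent swaps.
   Cutting each cycle into two segments B and S, the merged walk consists of two parallel rails that
   alternate between B and S. For odd n the n exchanges produce one cycle. For even n they would
   produce two, so one of the exchanges is replaced by one with the opposite orientation. The only
   case without room for this is n = m = 4, where a cycle is written down explicitly. *)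
theory Submission
  imports Defs
begin

subsection \<open>Additive weights of walks and alternating concatenations\<close>

fun wt :: "('a \<Rightarrow> 'a \<Rightarrow> nat) \<Rightarrow> 'a list \<Rightarrow> nat" where
  "wt f (x # y # zs) = f x y + wt f (y # zs)"
| "wt f _ = 0"

lemma wt_Cons: "xs \<noteq> [] \<Longrightarrow> wt f (x # xs) = f x (hd xs) + wt f xs"
  by (cases xs) auto

lemma wt_append:
  "xs \<noteq> [] \<Longrightarrow> ys \<noteq> [] \<Longrightarrow> wt f (xs @ ys) = wt f xs + f (last xs) (hd ys) + wt f ys"
  by (induction xs) (auto simp: wt_Cons hd_append)

lemma wt_rev:
  assumes "\<And>x y. f x y = f y x"
  shows "wt f (rev xs) = wt f xs"
proof (induction xs)
  case (Cons x xs)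
  then show ?case
    by (cases "xs = []") (auto simp: wt_append wt_Cons last_rev assms[of x])
qed simp

lemma wt_map: "wt f (map g xs) = wt (\<lambda>x y. f (g x) (g y)) xs"
  by (induction xs rule: induct_list012) auto

lemma wt_sum: "wt (\<lambda>x y. \<Sum>i\<in>A. f i x y) xs = (\<Sum>i\<in>A. wt (f i) xs)"
  by (induction xs rule: induct_list012) (auto simp: sum.distrib)

lemma wt_nth: "wt f xs = (\<Sum>i<length xs - 1. f (xs ! i) (xs ! Suc i))"
proof (induction f xs rule: wt.induct)
  case (1 f x y zs)
  then show ?case
    using sum.lessThan_Suc_shift[of "\<lambda>i. f ((x # y # zs) ! i) ((y # zs) ! i)" "length zs"]
    by simp
qed auto

text \<open>Reversing the function for the remaining entries encodes the alternation without a
  parity argument; inductions therefore generalize over \<open>f\<close>.\<close>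

primrec snake :: "('a \<Rightarrow> 'b list) \<Rightarrow> 'a list \<Rightarrow> 'b list" where
  "snake f [] = []"
| "snake f (x # xs) = f x @ snake (\<lambda>z. rev (f z)) xs"

lemma snake_append:
  "snake f (xs @ ys) = snake f xs @ snake (if even (length xs) then f else (\<lambda>z. rev (f z))) ys"
  by (induction xs arbitrary: f) auto

lemma set_snake: "set (snake f xs) = (\<Union>x\<in>set xs. set (f x))"
  by (induction xs arbitrary: f) auto

lemma length_snake: "(\<And>x. length (f x) = l) \<Longrightarrow> length (snake f xs) = l * length xs"
  by (induction xs arbitrary: f) auto

lemma distinct_snake:
  assumes "distinct xs" "\<And>x. x \<in> set xs \<Longrightarrow> distinct (f x)"
    "\<And>x y. x \<in> set xs \<Longrightarrow> y \<in> set xs \<Longrightarrow> x \<noteq> y \<Longrightarrow> set (f x) \<inter> set (f y) = {}"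
  shows "distinct (snake f xs)"
  using assms
proof (induction xs arbitrary: f)
  case (Cons a xs)
  have "distinct (snake (\<lambda>z. rev (f z)) xs)"
    using Cons.prems by (intro Cons.IH) auto
  moreover have "set (f a) \<inter> (\<Union>x\<in>set xs. set (f x)) = {}"
    using Cons.prems by fastforce
  ultimately show ?case
    using Cons.prems by (simp add: set_snake)
qed simp

lemma snake_eq_Nil: "(\<And>x. f x \<noteq> []) \<Longrightarrow> snake f xs = [] \<longleftrightarrow> xs = []"
  by (cases xs) auto

lemma hd_snake: "(\<And>x. f x \<noteq> []) \<Longrightarrow> xs \<noteq> [] \<Longrightarrow> hd (snake f xs) = hd (f (hd xs))"
  by (cases xs) auto

lemma last_snake:
  assumes "\<And>x. f x \<noteq> []" "xs \<noteq> []"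
  shows "last (snake f xs) = (if odd (length xs) then last (f (last xs)) else hd (f (last xs)))"
  using assms
proof (induction xs arbitrary: f)
  case (Cons a xs)
  then show ?case
    using Cons.IH[of "\<lambda>z. rev (f z)"] snake_eq_Nil[of "\<lambda>z. rev (f z)" xs]
    by (cases "xs = []") (auto simp: last_rev hd_rev)
qed simp

text \<open>Consecutive blocks are read in opposite directions and meet alternately at their last
  and their first entries, so \<open>E\<close> has to yield \<open>R\<close> at both ends.\<close>

lemma successively_snake:
  assumes "\<And>x. f x \<noteq> []" "successively E xs"
    "\<And>x. x \<in> set xs \<Longrightarrow> successively R (f x)"
    "\<And>x y. x \<in> set xs \<Longrightarrow> y \<in> set xs \<Longrightarrow> E x y \<Longrightarrow> R (hd (f x)) (hd (f y)) \<and> R (last (f x)) (last (f y))"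
    and sym: "\<And>x y. R x y \<Longrightarrow> R y x"
  shows "successively R (snake f xs)"
  using assms(1-4)
proof (induction xs arbitrary: f)
  case (Cons a xs)
  have RR: "successively R (rev ys) = successively R ys" for ys
  proof -
    have "(\<lambda>x y. R y x) = R" using sym by blast
    then show ?thesis by (metis successively_rev)
  qed
  have "successively R (snake (\<lambda>z. rev (f z)) xs)"
    using Cons.prems by (intro Cons.IH) (auto simp: RR simp del: successively_rev simp: hd_rev last_rev successively_Cons)
  then show ?case
    using Cons.prems snake_eq_Nil[of "\<lambda>z. rev (f z)" xs] hd_snake[of "\<lambda>z. rev (f z)" xs]
    by (cases "xs = []") (auto simp: successively_append_iff successively_Cons hd_rev)
qed simp

text \<open>There is one join fewer than there are blocks. The extra \<open>A\<close>, the price of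
  a closing join, avoids subtraction.\<close>

lemma wt_snake:
  assumes "\<And>x. f x \<noteq> []" "successively E xs" "xs \<noteq> []"
    "\<And>x. x \<in> set xs \<Longrightarrow> wt h (f x) = q"
    "\<And>x y. x \<in> set xs \<Longrightarrow> y \<in> set xs \<Longrightarrow> E x y \<Longrightarrow> h (hd (f x)) (hd (f y)) = A \<and> h (last (f x)) (last (f y)) = A"
    and sym: "\<And>x y. h x y = h y x"
  shows "wt h (snake f xs) + A = length xs * (q + A)"
  using assms(1-5)
proof (induction xs arbitrary: f)
  case (Cons a xs)
  show ?case
  proof (cases "xs = []")
    case False
    have "wt h (snake (\<lambda>z. rev (f z)) xs) + A = length xs * (q + A)"
      using Cons.prems False
      by (intro Cons.IH) (auto simp: wt_rev[of h, OF sym] hd_rev last_rev successively_Cons)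
    then show ?thesis
      using Cons.prems False snake_eq_Nil[of "\<lambda>z. rev (f z)" xs] hd_snake[of "\<lambda>z. rev (f z)" xs]
      by (auto simp: wt_append successively_Cons hd_rev)
  qed (use Cons.prems in simp)
qed simp

section \<open>Steps by transpositions and a criterion for rainbow cycles\<close>

definition adj :: "nat \<Rightarrow> (nat \<Rightarrow> nat) \<Rightarrow> (nat \<Rightarrow> nat) \<Rightarrow> bool" where
  "adj n \<pi> \<sigma> \<longleftrightarrow> (\<exists>a\<in>{1..n}. \<exists>b\<in>{1..n}. a \<noteq> b \<and> \<sigma> = transpose a b \<circ> \<pi>)"

definition step :: "nat \<Rightarrow> nat \<Rightarrow> (nat \<Rightarrow> nat) \<Rightarrow> (nat \<Rightarrow> nat) \<Rightarrow> nat" where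
  "step a b \<pi> \<sigma> = of_bool (\<sigma> = transpose a b \<circ> \<pi>)"

lemma adjI: "a \<in> {1..n} \<Longrightarrow> b \<in> {1..n} \<Longrightarrow> a \<noteq> b \<Longrightarrow> \<sigma> = transpose a b \<circ> \<pi> \<Longrightarrow> adj n \<pi> \<sigma>"
  unfolding adj_def by blast

lemma transpose_comp_flip: "\<sigma> = transpose a b \<circ> \<pi> \<longleftrightarrow> \<pi> = transpose a b \<circ> \<sigma>"
  by (auto simp: fun_eq_iff)

lemma adj_commute: "adj n \<pi> \<sigma> \<Longrightarrow> adj n \<sigma> \<pi>"
  unfolding adj_def by (subst transpose_comp_flip)

lemma step_commute: "step a b \<pi> \<sigma> = step a b \<sigma> \<pi>"
  unfolding step_def using transpose_comp_flip[of \<sigma> a b \<pi>] by simp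

lemma successively_adj_rev: "successively (adj n) (rev xs) = successively (adj n) xs"
proof -
  have "(\<lambda>x y. adj n y x) = adj n" using adj_commute by blast
  then show ?thesis by (metis successively_rev)
qed

text \<open>\<open>adj\<close> and \<open>step\<close> ignore the order of the two values and do not
  mention \<open>Perms n\<close>, which suits reversed walks and rotated values. Here they are
  translated back, with the closing step kept apart from the path.\<close>

lemma rainbow_cycleI:
  assumes len: "2 \<le> length xs" and sub: "set xs \<subseteq> Perms n" and dist: "distinct xs"
    and suc: "successively (adj n) xs" and closed: "adj n (last xs) (hd xs)"
    and cnt: "\<And>a b. a \<in> {1..n} \<Longrightarrow> b \<in> {1..n} \<Longrightarrow> a \<noteq> b \<Longrightarrow>
      wt (step a b) xs + step a b (last xs) (hd xs) = r"
  shows "rainbow_cycle n r xs"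
proof -
  have ne: "xs \<noteq> []" using len by auto
  obtain l where l: "length xs = Suc l" using len by (cases "length xs") auto
  have next_l: "cyc_next xs l = hd xs"
    using l ne by (simp add: cyc_next_def hd_conv_nth)
  have next_less: "cyc_next xs a = xs ! Suc a" if "a < l" for a
    using that l by (simp add: cyc_next_def)
  have last: "last xs = xs ! l" using ne l by (simp add: last_conv_nth)
  have adj: "adj n (xs ! a) (cyc_next xs a)" if "a < length xs" for a
    using that l next_l next_less last closed suc
    by (cases "a = l") (auto simp: successively_conv_nth)
  have in_Perms: "xs ! a \<in> Perms n" "cyc_next xs a \<in> Perms n" if "a < length xs" for a
    using that sub ne by (auto simp: cyc_next_def)
  have adjacent: "adjacent n (xs ! a) (cyc_next xs a)" if a: "a < length xs" for a
  proof -
    obtain c d where cd: "c \<in> {1..n}" "d \<in> {1..n}" "c \<noteq> d"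
      "cyc_next xs a = transpose c d \<circ> xs ! a"
      using adj[OF a] by (auto simp: adj_def)
    \<comment> \<open>A color is an ordered pair, so the two values are sorted.\<close>
    have "colored_edge n (min c d, max c d) (xs ! a) (cyc_next xs a)"
      using cd in_Perms[OF a]
      by (auto simp: colored_edge_def transpositions_def apply_transposition_def min_def max_def
          transpose_commute)
    then show ?thesis by (auto simp: adjacent_def)
  qed
  have "uses n t xs = r" if t: "t \<in> transpositions n" for t
  proof -
    obtain c d where t_eq: "t = (c, d)" and cd: "c \<in> {1..n}" "d \<in> {1..n}" "c \<noteq> d"
      using t by (auto simp: transpositions_def)
    have "{a. a < length xs \<and> colored_edge n t (xs ! a) (cyc_next xs a)}
        = {a\<in>{..<length xs}. cyc_next xs a = transpose c d \<circ> xs ! a}"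
      using t t_eq in_Perms by (auto simp: colored_edge_def apply_transposition_def)
    then have "uses n t xs = (\<Sum>a<length xs. step c d (xs ! a) (cyc_next xs a))"
      by (simp add: uses_def step_def of_bool_def sum.If_cases Int_def)
    also have "\<dots> = (\<Sum>a<l. step c d (xs ! a) (xs ! Suc a)) + step c d (last xs) (hd xs)"
      using l next_less by (simp add: next_l last)
    also have "\<dots> = r"
      using cnt[OF cd] l by (simp add: wt_nth)
    finally show ?thesis .
  qed
  then show ?thesis
    using len sub dist adjacent by (auto simp: rainbow_cycle_def)
qed

definition col :: "nat \<Rightarrow> nat \<Rightarrow> nat \<Rightarrow> nat \<Rightarrow> nat" where
  "col a b c d = of_bool (transpose c d = transpose a b)"

lemma col_commute: "col a b c d = col a b d c"
  by (simp add: col_def transpose_commute)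

lemma transposes_eq_iff:
  assumes "a \<noteq> b"
  shows "transpose c d = transpose a b \<longleftrightarrow> c = a \<and> d = b \<or> c = b \<and> d = a"
proof
  assume eq: "transpose c d = transpose a b"
  show "c = a \<and> d = b \<or> c = b \<and> d = a"
    using fun_cong[OF eq, of a] fun_cong[OF eq, of c] fun_cong[OF eq, of d] assms
    by (auto simp: transpose_def split: if_splits)
qed (auto simp: transpose_commute)

lemma col_eq: "a \<noteq> b \<Longrightarrow> col a b c d = of_bool (c = a \<and> d = b \<or> c = b \<and> d = a)"
  by (simp add: col_def transposes_eq_iff)

lemma step_transpose:
  assumes "bij \<pi>"
  shows "step a b \<pi> (transpose c d \<circ> \<pi>) = col a b c d"
proof -
  have "transpose c d \<circ> \<pi> = transpose a b \<circ> \<pi> \<longleftrightarrow> transpose c d = transpose a b"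
    using bij_is_surj[OF assms] by (metis comp_apply ext surjD)
  then show ?thesis by (simp add: step_def col_def)
qed

text \<open>Conjugation relabels the two points of a transposition; all computations with rotated
  colors rest on this.\<close>

lemma comp_transpose: "bij f \<Longrightarrow> f \<circ> transpose a b = transpose (f a) (f b) \<circ> f"
  by (simp add: fun_eq_iff transpose_def inj_eq[OF bij_is_inj])

subsection \<open>Rotating the values\<close>

locale gray =
  fixes n :: nat
  assumes n2: "2 \<le> n"
begin

definition rot :: "nat \<Rightarrow> nat" where
  "rot x = (if x \<in> {1..n} then x mod n + 1 else x)"

definition lift :: "nat \<Rightarrow> (nat \<Rightarrow> nat) list \<Rightarrow> (nat \<Rightarrow> nat) list" where
  "lift i = map (\<lambda>\<pi>. (rot ^^ i) \<circ> \<pi>)"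

lemma rot_pow: "x \<in> {1..n} \<Longrightarrow> (rot ^^ i) x = (x - 1 + i) mod n + 1"
proof (induction i)
  case (Suc i)
  have "(x - 1 + i) mod n < n" using n2 by simp
  then have "rot ((x - 1 + i) mod n + 1) = (x - 1 + Suc i) mod n + 1"
    by (simp add: rot_def mod_Suc_eq)
  then show ?case using Suc by simp
qed auto

lemma rot_pow_outside: "x \<notin> {1..n} \<Longrightarrow> (rot ^^ i) x = x"
  by (induction i) (auto simp: rot_def)

lemma rot_pow_n: "rot ^^ n = id"
proof
  show "(rot ^^ n) x = id x" for x
  proof (cases "x \<in> {1..n}")
    case True
    then obtain y where "x = Suc y" "y < n" by (cases x) auto
    then show ?thesis using rot_pow[OF True, of n] by simp
  qed (simp add: rot_pow_outside)
qed

lemma rot_pow_mem: "x \<in> {1..n} \<Longrightarrow> (rot ^^ i) x \<in> {1..n}"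
  using n2 by (simp add: rot_pow Suc_le_eq)

lemma inj_rot_pow: "inj (rot ^^ i)"
proof (rule inj_fn, rule injI)
  fix x y assume "rot x = rot y"
  moreover have "x mod n = (if x = n then 0 else x)" if "x \<in> {1..n}" for x
    using that by auto
  ultimately show "x = y"
    using n2 by (auto simp: rot_def split: if_splits)
qed

lemma rot_pow_permutes: "(rot ^^ i) permutes {1..n}"
proof -
  have "(rot ^^ i) ` {1..n} \<subseteq> {1..n}" using rot_pow_mem by blast
  then have "bij_betw (rot ^^ i) {1..n} {1..n}"
    by (simp add: bij_betw_def endo_inj_surj inj_on_subset[OF inj_rot_pow])
  then show ?thesis using rot_pow_outside by (rule bij_imp_permutes)
qed

lemma bij_rot_pow: "bij (rot ^^ i)"
  using rot_pow_permutes permutes_bij by blast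

lemma rot_Suc: "x \<in> {1..<n} \<Longrightarrow> rot x = Suc x"
  by (simp add: rot_def)

lemma rot_n: "rot n = 1"
  using n2 by (simp add: rot_def)

lemma rot_transpose: "(rot ^^ i) \<circ> (transpose a b \<circ> \<pi>)
    = transpose ((rot ^^ i) a) ((rot ^^ i) b) \<circ> ((rot ^^ i) \<circ> \<pi>)"
  using comp_transpose[OF bij_rot_pow] by (metis comp_assoc)

lemma adj_lift: "adj n \<pi> \<sigma> \<Longrightarrow> adj n ((rot ^^ i) \<circ> \<pi>) ((rot ^^ i) \<circ> \<sigma>)"
  unfolding adj_def
  by (metis rot_transpose rot_pow_mem inj_rot_pow injD)

lemma successively_lift: "successively (adj n) xs \<Longrightarrow> successively (adj n) (lift i xs)"
  unfolding lift_def successively_map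
  by (erule successively_mono) (rule adj_lift)

lemma lift_simps [simp]:
  "lift i (xs @ ys) = lift i xs @ lift i ys" "lift i [] = []" "lift i xs = [] \<longleftrightarrow> xs = []"
  "lift i (rev xs) = rev (lift i xs)" "length (lift i xs) = length xs"
  by (auto simp: lift_def rev_map)

lemma hd_lift: "xs \<noteq> [] \<Longrightarrow> hd (lift i xs) = (rot ^^ i) \<circ> hd xs"
  and last_lift: "xs \<noteq> [] \<Longrightarrow> last (lift i xs) = (rot ^^ i) \<circ> last xs"
  by (auto simp: lift_def hd_map last_map)

lemma set_lift: "set (lift i xs) = (\<lambda>\<pi>. (rot ^^ i) \<circ> \<pi>) ` set xs"
  by (simp add: lift_def)

lemma distinct_lift: "distinct xs \<Longrightarrow> distinct (lift i xs)"
proof -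
  have "inj_on (\<lambda>\<pi>. (rot ^^ i) \<circ> \<pi>) (set xs)"
    using inj_rot_pow by (auto simp: inj_def inj_on_def fun_eq_iff)
  then show "distinct xs \<Longrightarrow> distinct (lift i xs)"
    by (simp add: lift_def distinct_map)
qed

lemma step_lift:
  assumes "bij \<pi>"
  shows "step a b ((rot ^^ i) \<circ> \<pi>) ((rot ^^ i) \<circ> (transpose c d \<circ> \<pi>))
    = col a b ((rot ^^ i) c) ((rot ^^ i) d)"
  unfolding rot_transpose using assms bij_comp bij_rot_pow by (intro step_transpose) blast

section \<open>Counting a color over all rotations\<close>

definition orbit_step :: "nat \<Rightarrow> nat \<Rightarrow> (nat \<Rightarrow> nat) \<Rightarrow> (nat \<Rightarrow> nat) \<Rightarrow> nat" where
  "orbit_step a b \<pi> \<sigma> = (\<Sum>i<n. step a b ((rot ^^ i) \<circ> \<pi>) ((rot ^^ i) \<circ> \<sigma>))"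

definition orbit_col :: "nat \<Rightarrow> nat \<Rightarrow> nat \<Rightarrow> nat \<Rightarrow> nat" where
  "orbit_col a b c d = (\<Sum>i<n. col a b ((rot ^^ i) c) ((rot ^^ i) d))"

lemma wt_orbit_step: "wt (orbit_step a b) xs = (\<Sum>i<n. wt (step a b) (lift i xs))"
  by (simp add: orbit_step_def[abs_def] wt_sum lift_def wt_map)

lemma orbit_step_commute: "orbit_step a b \<pi> \<sigma> = orbit_step a b \<sigma> \<pi>"
  by (simp add: orbit_step_def step_commute)

lemma orbit_step_transpose:
  "bij \<pi> \<Longrightarrow> orbit_step a b \<pi> (transpose c d \<circ> \<pi>) = orbit_col a b c d"
  by (simp add: orbit_step_def orbit_col_def step_lift)

lemma orbit_col_commute: "orbit_col a b c d = orbit_col a b d c"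
  by (simp add: orbit_col_def col_commute)

text \<open>Rotating \<open>c\<close> and \<open>d\<close> shifts the summation index by one, and
  the term that leaves the sum equals the one that enters because \<open>rot ^^ n\<close> is the
  identity.\<close>

lemma orbit_col_rot: "orbit_col a b (rot c) (rot d) = orbit_col a b c d"
proof -
  let ?g = "\<lambda>i. col a b ((rot ^^ i) c) ((rot ^^ i) d)"
  have "?g n + (\<Sum>i<n. ?g i) = (\<Sum>i<Suc n. ?g i)" by simp
  also have "\<dots> = ?g 0 + (\<Sum>i<n. ?g (Suc i))" by (rule sum.lessThan_Suc_shift)
  finally have "(\<Sum>i<n. ?g (Suc i)) = (\<Sum>i<n. ?g i)" by (simp add: rot_pow_n)
  then show ?thesis by (simp add: orbit_col_def funpow_swap1)
qed

text \<open>The pairs of cyclically adjacent values form a single orbit under rotation, represented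
  by the pair of \<open>n\<close> and 1.\<close>

lemma orbit_col_adjacent:
  assumes "1 \<le> v" "v < n"
  shows "orbit_col a b v (Suc v) = orbit_col a b n 1"
  using assms
proof (induction v rule: dec_induct)
  case base
  show ?case using orbit_col_rot[of a b n 1] n2 by (simp add: rot_n rot_Suc)
next
  case (step v)
  then show ?case using orbit_col_rot[of a b v "Suc v"] by (simp add: rot_Suc)
qed

text \<open>Over the \<open>n\<close> rotations, the star of all pairs (1, d) runs once through the
  stars at all values, and the pair of \<open>a\<close> and \<open>b\<close> lies in exactly two of
  them.\<close>

lemma orbit_col_star:
  assumes "a \<in> {1..n}" "b \<in> {1..n}" "a \<noteq> b"
  shows "(\<Sum>d\<in>{2..n}. orbit_col a b 1 d) = 2"
proof -
  have inner: "(\<Sum>d\<in>{2..n}. col a b ((rot ^^ i) 1) ((rot ^^ i) d))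
      = of_bool (Suc i = a) + of_bool (Suc i = b)" if "i < n" for i
  proof -
    have one: "(rot ^^ i) 1 = Suc i" using that n2 by (simp add: rot_pow)
    have "bij_betw (rot ^^ i) {1..n} {1..n}"
      using rot_pow_permutes permutes_imp_bij by blast
    \<comment> \<open>Rotation \<open>i\<close> yields the star at \<open>Suc i\<close>: the values
      other than 1 are mapped onto the values other than \<open>Suc i\<close>.\<close>
    then have "bij_betw (rot ^^ i) ({1..n} - {1}) ({1..n} - {(rot ^^ i) 1})"
      using n2 by (intro bij_betw_DiffI) (auto simp: bij_betw_def)
    moreover have "{1..n} - {1} = {2..n}" by auto
    ultimately have "bij_betw (rot ^^ i) {2..n} ({1..n} - {Suc i})" by (simp only: one)
    from sum.reindex_bij_betw[OF this, of "col a b (Suc i)"]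
    have "(\<Sum>d\<in>{2..n}. col a b ((rot ^^ i) 1) ((rot ^^ i) d)) = (\<Sum>e\<in>{1..n} - {Suc i}. col a b (Suc i) e)"
      by (simp only: one)
    also have "\<dots> = (\<Sum>e\<in>{1..n} - {Suc i}. of_bool (Suc i = a \<and> e = b) + of_bool (Suc i = b \<and> e = a))"
      using assms by (intro sum.cong) (auto simp: col_eq)
    also have "\<dots> = of_bool (Suc i = a) + of_bool (Suc i = b)"
      using assms by (simp add: sum.distrib of_bool_conj flip: sum_distrib_left)
    finally show ?thesis .
  qed
  have "(\<Sum>d\<in>{2..n}. orbit_col a b 1 d) = (\<Sum>i<n. \<Sum>d\<in>{2..n}. col a b ((rot ^^ i) 1) ((rot ^^ i) d))"
    unfolding orbit_col_def by (rule sum.swap)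
  also have "\<dots> = (\<Sum>i<n. of_bool (Suc i = a) + of_bool (Suc i = b))"
    by (intro sum.cong) (use inner in auto)
  also have "\<dots> = (\<Sum>p\<in>{1..n}. of_bool (p = a) + of_bool (p = b))"
    by (rule sum.reindex_bij_witness[of _ "\<lambda>p. p - 1" Suc]) auto
  also have "\<dots> = 2"
    using assms by (simp add: sum.distrib of_bool_def)
  finally show ?thesis .
qed

section \<open>Tiles\<close>

text \<open>The word of \<open>\<tau> \<circ> lam j\<close> arises from that of \<open>\<tau>\<close> by moving the first entry to position \<open>j + 1\<close>.\<close>

definition lam :: "nat \<Rightarrow> nat \<Rightarrow> nat" where
  "lam j p = (if 1 \<le> p \<and> p \<le> j then Suc p else if p = Suc j then 1 else p)"

definition tile :: "(nat \<Rightarrow> nat) \<Rightarrow> (nat \<Rightarrow> nat) list" where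
  "tile \<tau> = map (\<lambda>j. \<tau> \<circ> lam j) [0..<n - 1]"

lemma lam_0: "lam 0 = id"
  by (auto simp: lam_def)

text \<open>The word of \<open>lam j\<close> is 2, ..., j + 1, 1, j + 2, ..., so interchanging the
  neighbouring entries 1 and j + 2 moves 1 one position to the right.\<close>

lemma lam_Suc: "lam (Suc j) = transpose 1 (j + 2) \<circ> lam j"
  by (auto simp: lam_def transpose_def fun_eq_iff)

lemma lam_1: "lam 1 = transpose 1 2"
  using lam_Suc[of 0] by (simp add: lam_0 numeral_2_eq_2)

lemma lam_permutes: "j + 1 \<le> k \<Longrightarrow> lam j permutes {1..k}"
proof (induction j)
  case 0
  show ?case by (simp only: lam_0 permutes_id)
next
  case (Suc j)
  then show ?case unfolding lam_Suc
    by (intro permutes_compose permutes_swap_id) auto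
qed

lemma bij_lam: "bij (lam j)"
  using lam_permutes[of j "j + 1"] permutes_bij by blast

text \<open>The word of \<open>lam (n - 2)\<close> is 2, ..., n - 1, 1, n, and interchanging n and 1
  gives the word 2, ..., n, 1 of \<open>rot\<close>. This links the end of \<open>tile id\<close> to
  the start of its rotated copy.\<close>

lemma transpose_lam: "transpose n 1 \<circ> lam (n - 2) = rot"
proof
  fix x
  have "x mod n = (if x = n then 0 else x)" if "x \<in> {1..n}"
    using that by auto
  then show "(transpose n 1 \<circ> lam (n - 2)) x = rot x"
    using n2 by (auto simp: lam_def transpose_def rot_def)
qed

lemma length_tile [simp]: "length (tile \<tau>) = n - 1"
  by (simp add: tile_def)

lemma tile_nonempty [simp]: "tile \<tau> \<noteq> []"
  using n2 by (simp add: tile_def)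

lemma hd_tile: "hd (tile \<tau>) = \<tau>"
  using n2 by (simp add: tile_def hd_map lam_0)

lemma last_tile: "last (tile \<tau>) = \<tau> \<circ> lam (n - 2)"
  using n2 by (simp add: tile_def last_map numeral_2_eq_2)

lemma set_tile: "set (tile \<tau>) = (\<lambda>j. \<tau> \<circ> lam j) ` {..<n - 1}"
  by (auto simp: tile_def)

lemma tile_step:
  assumes "bij \<tau>" "\<tau> 1 = 1"
  shows "\<tau> \<circ> lam (Suc j) = transpose 1 (\<tau> (j + 2)) \<circ> (\<tau> \<circ> lam j)"
  unfolding lam_Suc using comp_transpose[OF assms(1), of 1 "j + 2"] assms(2)
  by (metis comp_assoc)

lemma wt_map_upt: "wt f (map g [0..<Suc k]) = (\<Sum>j<k. f (g j) (g (Suc j)))"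
  by (simp add: wt_nth del: upt_Suc)

lemma sum_tile:
  assumes "\<tau> permutes {2..n - 1}"
  shows "(\<Sum>j<n - 2. F (\<tau> (j + 2))) = (\<Sum>d\<in>{2..n - 1}. F d :: nat)"
proof -
  have "(\<Sum>j<n - 2. F (\<tau> (j + 2))) = (\<Sum>d\<in>{2..n - 1}. F (\<tau> d))"
    using n2 by (intro sum.reindex_bij_witness[of _ "\<lambda>d. d - 2" "\<lambda>j. j + 2"]) auto
  also have "\<dots> = (\<Sum>d\<in>{2..n - 1}. F d)"
    using sum.permute[OF assms, of F] by (simp add: o_def)
  finally show ?thesis .
qed

lemma permutes_fix:
  assumes "\<tau> permutes {2..n - 1}"
  shows "bij \<tau>" "\<tau> 1 = 1" "\<tau> n = n"
  using assms permutes_bij n2 by (auto simp: permutes_not_in)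

text \<open>The steps of a tile have the colors (1, \<tau> 2), ..., (1, \<tau> (n - 1)), hence each
  (1, d) with 2 <= d < n once, whatever \<tau> is. Leaving \<open>h\<close> open covers a single
  rotation as well as the sum over all of them.\<close>

lemma wt_tile_generic:
  assumes "\<tau> permutes {2..n - 1}"
    and "\<And>\<pi> c d. bij \<pi> \<Longrightarrow> h \<pi> (transpose c d \<circ> \<pi>) = F c d"
  shows "wt h (tile \<tau>) = (\<Sum>d\<in>{2..n - 1}. F 1 d)"
proof -
  have "wt h (tile \<tau>) = (\<Sum>j<n - 2. h (\<tau> \<circ> lam j) (\<tau> \<circ> lam (Suc j)))"
    using wt_map_upt[of h "\<lambda>j. \<tau> \<circ> lam j" "n - 2"] n2
    by (simp add: tile_def Suc_diff_Suc numeral_2_eq_2 del: upt_Suc)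
  also have "\<dots> = (\<Sum>j<n - 2. F 1 (\<tau> (j + 2)))"
    using permutes_fix[OF assms(1)] bij_lam
    by (intro sum.cong) (simp_all only: tile_step assms(2) bij_comp)
  finally show ?thesis using sum_tile[OF assms(1)] by simp
qed

text \<open>A tile misses only the pair (1, n) of the star at 1, and one swap of cyclically adjacent
  values makes up for it.\<close>

lemma wt_orbit_tile:
  assumes "a \<in> {1..n}" "b \<in> {1..n}" "a \<noteq> b" "\<tau> permutes {2..n - 1}"
  shows "wt (orbit_step a b) (tile \<tau>) + orbit_col a b n 1 = 2"
proof -
  have "{2..n} = insert n {2..n - 1}" using n2 by auto
  then have "(\<Sum>d\<in>{2..n}. orbit_col a b 1 d) = orbit_col a b 1 n + (\<Sum>d\<in>{2..n - 1}. orbit_col a b 1 d)"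
    using n2 by simp
  moreover have "wt (orbit_step a b) (tile \<tau>) = (\<Sum>d\<in>{2..n - 1}. orbit_col a b 1 d)"
    using assms(4) orbit_step_transpose by (rule wt_tile_generic)
  ultimately show ?thesis
    using orbit_col_star[OF assms(1-3)] orbit_col_commute[of a b 1 n] by simp
qed

lemma wt_lift_tile:
  assumes "\<tau> permutes {2..n - 1}"
  shows "wt (step a b) (lift i (tile \<tau>)) = (\<Sum>d\<in>{2..n - 1}. col a b ((rot ^^ i) 1) ((rot ^^ i) d))"
  unfolding lift_def wt_map
  by (rule wt_tile_generic[OF assms]) (rule step_lift)

lemma successively_tile:
  assumes "\<tau> permutes {2..n - 1}"
  shows "successively (adj n) (tile \<tau>)"
proof -
  have "adj n (\<tau> \<circ> lam j) (\<tau> \<circ> lam (Suc j))" if "j < n - 2" for j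
  proof (rule adjI)
    show "\<tau> (j + 2) \<in> {1..n}" "1 \<noteq> \<tau> (j + 2)"
      using permutes_in_image[OF assms, of "j + 2"] that by auto
    show "\<tau> \<circ> lam (Suc j) = transpose 1 (\<tau> (j + 2)) \<circ> (\<tau> \<circ> lam j)"
      using permutes_fix[OF assms] by (intro tile_step)
  qed (use n2 in auto)
  then show ?thesis
    by (auto simp: successively_conv_nth tile_def)
qed

lemma tile_permutes:
  assumes "\<tau> permutes {2..n - 1}" "\<pi> \<in> set (tile \<tau>)"
  shows "\<pi> permutes {1..n - 1}"
proof -
  obtain j where j: "j < n - 1" "\<pi> = \<tau> \<circ> lam j" using assms(2) by (auto simp: set_tile)
  have "\<tau> permutes {1..n - 1}" using assms(1) by (rule permutes_subset) auto
  then show ?thesis using j lam_permutes[of j "n - 1"] permutes_compose by auto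
qed

text \<open>The position \<open>Suc j\<close> of the value 1 reveals \<open>j\<close>; then the
  bijection \<open>lam j\<close> is cancelled.\<close>

lemma tile_inj:
  assumes "\<tau> permutes {2..n - 1}" "\<tau>' permutes {2..n - 1}" "\<tau> \<circ> lam j = \<tau>' \<circ> lam j'"
  shows "j = j'" "\<tau> = \<tau>'"
proof -
  have "\<tau> (lam j (Suc j)) = 1" "\<tau>' (lam j' (Suc j')) = 1"
    using permutes_fix(2)[OF assms(1)] permutes_fix(2)[OF assms(2)] by (auto simp: lam_def)
  then have "(\<tau>' \<circ> lam j') (Suc j) = (\<tau>' \<circ> lam j') (Suc j')"
    using assms(3) by (metis comp_apply)
  moreover have "inj (\<tau>' \<circ> lam j')"
    using permutes_fix(1)[OF assms(2)] bij_lam bij_comp bij_is_inj by blast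
  ultimately show "j = j'" by (metis injD nat.inject)
  then have "\<tau> \<circ> lam j = \<tau>' \<circ> lam j" using assms(3) by simp
  then show "\<tau> = \<tau>'"
    using bij_is_surj[OF bij_lam[of j]] by (metis comp_apply ext surjD)
qed

lemma distinct_tile: "\<tau> permutes {2..n - 1} \<Longrightarrow> distinct (tile \<tau>)"
  using tile_inj(1)[of \<tau> \<tau>] by (auto simp: tile_def distinct_map inj_on_def)

lemma tile_disjoint:
  "\<tau> permutes {2..n - 1} \<Longrightarrow> \<tau>' permutes {2..n - 1} \<Longrightarrow> \<tau> \<noteq> \<tau>' \<Longrightarrow> set (tile \<tau>) \<inter> set (tile \<tau>') = {}"
  using tile_inj(2)[of \<tau> \<tau>'] by (auto simp: set_tile)

subsection \<open>Merging the rotated copies of a cycle\<close>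

lemma rot_pow_n_inj: "i < n \<Longrightarrow> j < n \<Longrightarrow> (rot ^^ i) n = (rot ^^ j) n \<Longrightarrow> i = j"
proof -
  have *: "(rot ^^ i) n = (if i = 0 then n else i)" if "i < n" for i
  proof (cases i)
    case (Suc k)
    have "(n - 1 + i) mod n = (k + n) mod n" using Suc n2 by (simp add: add.commute)
    then show ?thesis using Suc that rot_pow[of n i] n2 by simp
  qed simp
  show "i < n \<Longrightarrow> j < n \<Longrightarrow> (rot ^^ i) n = (rot ^^ j) n \<Longrightarrow> i = j"
    by (auto simp: * split: if_splits)
qed

lemma lift_in_Perms: "\<pi> permutes {1..n - 1} \<Longrightarrow> (rot ^^ i) \<circ> \<pi> \<in> Perms n"
  using permutes_subset[of \<pi> "{1..n - 1}" "{1..n}"] permutes_compose[OF _ rot_pow_permutes]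
  by (auto simp: Perms_def)

lemma lift_n: "\<pi> permutes {1..n - 1} \<Longrightarrow> ((rot ^^ i) \<circ> \<pi>) n = (rot ^^ i) n"
  using n2 by (simp add: permutes_not_in)

lemma link_transpose:
  assumes "transpose n 1 \<circ> \<pi> = rot \<circ> \<sigma>"
  shows "(rot ^^ Suc i) \<circ> \<sigma> = transpose ((rot ^^ i) n) ((rot ^^ i) 1) \<circ> ((rot ^^ i) \<circ> \<pi>)"
proof -
  have "(rot ^^ Suc i) \<circ> \<sigma> = (rot ^^ i) \<circ> (rot \<circ> \<sigma>)"
    by (simp add: funpow_swap1 fun_eq_iff)
  then show ?thesis unfolding assms[symmetric] by (simp only: rot_transpose)
qed

lemma adj_link:
  assumes "transpose n 1 \<circ> \<pi> = rot \<circ> \<sigma>"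
  shows "adj n ((rot ^^ i) \<circ> \<pi>) ((rot ^^ Suc i) \<circ> \<sigma>)"
proof (rule adjI)
  show "(rot ^^ i) n \<noteq> (rot ^^ i) 1"
    using inj_eq[OF inj_rot_pow[of i], of n 1] n2 by simp
  show "(rot ^^ Suc i) \<circ> \<sigma> = transpose ((rot ^^ i) n) ((rot ^^ i) 1) \<circ> ((rot ^^ i) \<circ> \<pi>)"
    by (rule link_transpose[OF assms])
  show "(rot ^^ i) n \<in> {1..n}" "(rot ^^ i) 1 \<in> {1..n}"
    by (rule rot_pow_mem, use n2 in simp)+
qed

lemma step_link:
  assumes "transpose n 1 \<circ> \<pi> = rot \<circ> \<sigma>" "bij \<pi>"
  shows "step a b ((rot ^^ i) \<circ> \<pi>) ((rot ^^ Suc i) \<circ> \<sigma>) = col a b ((rot ^^ i) n) ((rot ^^ i) 1)"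
  unfolding link_transpose[OF assms(1)] using assms(2) bij_comp bij_rot_pow
  by (intro step_transpose) blast

text \<open>These are the two pieces of a cycle after deleting the edges between them, so these
  edges are not demanded. In their place, (n, 1) leads from the end of \<open>B\<close> to the end
  of \<open>S\<close> in the next copy, and from the start of \<open>S\<close> to the start of
  \<open>B\<close>.\<close>

definition segs :: "(nat \<Rightarrow> nat) list \<Rightarrow> (nat \<Rightarrow> nat) list \<Rightarrow> bool" where
  "segs B S \<longleftrightarrow> B \<noteq> [] \<and> S \<noteq> [] \<and> successively (adj n) B \<and> successively (adj n) S \<and>
     distinct (B @ S) \<and> (\<forall>\<pi>\<in>set (B @ S). \<pi> permutes {1..n - 1}) \<and>
     transpose n 1 \<circ> last B = rot \<circ> last S \<and> transpose n 1 \<circ> hd S = rot \<circ> hd B"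

text \<open>The rails \<open>xs\<close> and \<open>ys\<close> together cover the first \<open>k + 1\<close> rotated copies of the cycle \<open>B @ S\<close>.
  The copies do not overlap since the copy with index \<open>i\<close> has the entry \<open>(rot ^^ i) n\<close> in position \<open>n\<close>.\<close>

definition rails :: "(nat \<Rightarrow> nat) list \<Rightarrow> (nat \<Rightarrow> nat) list \<Rightarrow> nat \<Rightarrow>
    (nat \<Rightarrow> nat) list \<Rightarrow> (nat \<Rightarrow> nat) list \<Rightarrow> bool" where
  "rails B S k xs ys \<longleftrightarrow> xs \<noteq> [] \<and> ys \<noteq> [] \<and> successively (adj n) xs \<and> successively (adj n) ys \<and>
     distinct (xs @ ys) \<and> (\<forall>\<pi>\<in>set (xs @ ys). \<pi> \<in> Perms n \<and> (\<exists>i\<le>k. \<pi> n = (rot ^^ i) n)) \<and>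
     last xs = (rot ^^ k) \<circ> last B \<and> last ys = (rot ^^ k) \<circ> hd S \<and>
     length (xs @ ys) = Suc k * length (B @ S) \<and>
     (\<forall>a b. wt (step a b) xs + wt (step a b) ys =
       (\<Sum>i\<le>k. wt (step a b) (lift i B) + wt (step a b) (lift i S)) +
       (\<Sum>i<k. 2 * col a b ((rot ^^ i) n) ((rot ^^ i) 1)))"

lemma segs_permutes:
  assumes "segs B S"
  shows "bij (last B)" "bij (hd S)"
proof -
  have "last B permutes {1..n - 1}" "hd S permutes {1..n - 1}"
    using assms by (auto simp: segs_def)
  then show "bij (last B)" "bij (hd S)" using permutes_bij by blast+
qed

text \<open>The rail that stopped at the start of \<open>S\<close> goes on with \<open>B\<close>;
  the one that stopped at the end of \<open>B\<close> goes on with \<open>S\<close> read backwards.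
  The rails thereby exchange roles, hence the swapped order in the conclusion.\<close>

lemma rails_step:
  assumes BS: "segs B S" and r: "rails B S k xs ys" and k: "Suc k < n"
  shows "rails B S (Suc k) (ys @ lift (Suc k) B) (xs @ lift (Suc k) (rev S))"
proof -
  note B = BS[unfolded segs_def] and R = r[unfolded rails_def]
  let ?zs = "lift (Suc k) B @ lift (Suc k) (rev S)"
  have zs: "\<pi> \<in> Perms n \<and> \<pi> n = (rot ^^ Suc k) n" if "\<pi> \<in> set ?zs" for \<pi>
    using that B lift_in_Perms lift_n by (auto simp: set_lift simp del: funpow.simps)
  have new: "\<pi> \<notin> set (xs @ ys)" if "\<pi> \<in> set ?zs" for \<pi>
  proof
    assume "\<pi> \<in> set (xs @ ys)"
    then obtain i where "i \<le> k" "\<pi> n = (rot ^^ i) n" using R by blast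
    then show False using zs[OF that] rot_pow_n_inj[of i "Suc k"] k by auto
  qed
  have "distinct ?zs"
    using distinct_lift[of "B @ S" "Suc k"] B by auto
  then have dist: "distinct ((ys @ lift (Suc k) B) @ xs @ lift (Suc k) (rev S))"
    using R new by auto
  have joins: "adj n (last ys) (hd (lift (Suc k) B))" "adj n (last xs) (hd (lift (Suc k) (rev S)))"
    using B R adj_link by (auto simp: hd_lift last_lift hd_rev simp del: funpow.simps)
  have costs: "step a b (last ys) (hd (lift (Suc k) B)) = col a b ((rot ^^ k) n) ((rot ^^ k) 1)"
    "step a b (last xs) (hd (lift (Suc k) (rev S))) = col a b ((rot ^^ k) n) ((rot ^^ k) 1)" for a b
    using B R step_link segs_permutes[OF BS]
    by (auto simp: hd_lift last_lift hd_rev simp del: funpow.simps)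
  have wt: "wt (step a b) (ys @ lift (Suc k) B) + wt (step a b) (xs @ lift (Suc k) (rev S)) =
       (\<Sum>i\<le>Suc k. wt (step a b) (lift i B) + wt (step a b) (lift i S)) +
       (\<Sum>i<Suc k. 2 * col a b ((rot ^^ i) n) ((rot ^^ i) 1))" for a b
  proof -
    have "wt (step a b) (ys @ lift (Suc k) B) =
        wt (step a b) ys + col a b ((rot ^^ k) n) ((rot ^^ k) 1) + wt (step a b) (lift (Suc k) B)"
      using B R costs(1)[of a b] by (subst wt_append) auto
    moreover have "wt (step a b) (xs @ lift (Suc k) (rev S)) =
        wt (step a b) xs + col a b ((rot ^^ k) n) ((rot ^^ k) 1) + wt (step a b) (lift (Suc k) S)"
      using B R costs(2)[of a b] by (subst wt_append) (auto simp: wt_rev step_commute)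
    moreover have "wt (step a b) xs + wt (step a b) ys =
        (\<Sum>i\<le>k. wt (step a b) (lift i B) + wt (step a b) (lift i S)) +
        (\<Sum>i<k. 2 * col a b ((rot ^^ i) n) ((rot ^^ i) 1))"
      using R by blast
    ultimately show ?thesis by simp
  qed
  have suc: "successively (adj n) (ys @ lift (Suc k) B)"
    "successively (adj n) (xs @ lift (Suc k) (rev S))"
    using B R joins successively_lift[of B "Suc k"] successively_lift[of "rev S" "Suc k"]
    by (auto simp: successively_append_iff successively_adj_rev simp del: funpow.simps successively_rev lift_simps(4))
  have mem: "\<forall>\<pi>\<in>set ((ys @ lift (Suc k) B) @ xs @ lift (Suc k) (rev S)).
      \<pi> \<in> Perms n \<and> (\<exists>i\<le>Suc k. \<pi> n = (rot ^^ i) n)"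
  proof
    fix \<pi> assume "\<pi> \<in> set ((ys @ lift (Suc k) B) @ xs @ lift (Suc k) (rev S))"
    then have "\<pi> \<in> set (xs @ ys) \<or> \<pi> \<in> set ?zs" by auto
    then show "\<pi> \<in> Perms n \<and> (\<exists>i\<le>Suc k. \<pi> n = (rot ^^ i) n)"
      using R zs le_SucI order_refl by metis
  qed
  have ends: "last (ys @ lift (Suc k) B) = (rot ^^ Suc k) \<circ> last B"
    "last (xs @ lift (Suc k) (rev S)) = (rot ^^ Suc k) \<circ> hd S"
    using B by (simp_all add: last_lift last_rev hd_lift del: funpow.simps)
  have "length ((ys @ lift (Suc k) B) @ xs @ lift (Suc k) (rev S)) = Suc (Suc k) * length (B @ S)"
    using R by simp
  then show ?thesis
    unfolding rails_def using R dist wt suc mem ends by blast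
qed

text \<open>Two steps give each rail its role back, so an even number of steps keeps the starts of
  both rails in place.\<close>

lemma rails_complete:
  assumes "segs B S" "rails B S k xs ys" "k + 2 * t < n"
  shows "\<exists>xs' ys'. rails B S (k + 2 * t) xs' ys' \<and> hd xs' = hd xs \<and> hd ys' = hd ys"
  using assms(3)
proof (induction t)
  case 0
  then show ?case using assms(2) by auto
next
  case (Suc t)
  then obtain xs' ys' where IH: "rails B S (k + 2 * t) xs' ys'" "hd xs' = hd xs" "hd ys' = hd ys"
    by auto
  note one = rails_step[OF assms(1) IH(1)]
  note two = rails_step[OF assms(1) one]
  have "rails B S (k + 2 * Suc t)
      ((xs' @ lift (Suc (k + 2 * t)) (rev S)) @ lift (Suc (Suc (k + 2 * t))) B)
      ((ys' @ lift (Suc (k + 2 * t)) B) @ lift (Suc (Suc (k + 2 * t))) (rev S))"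
    using two Suc.prems by simp
  moreover have "xs' \<noteq> []" "ys' \<noteq> []" using IH(1) by (auto simp: rails_def)
  ultimately show ?case using IH(2,3) by (metis append_assoc hd_append2)
qed

text \<open>As \<open>rot ^^ n\<close> is the identity, the last links lead back to copy 0. With
  these starts, each rail is linked to the start of the other; with the starts exchanged, each would
  close on itself and give two cycles.\<close>

lemma rails_close:
  assumes BS: "segs B S" and r: "rails B S (n - 1) xs ys"
    and heads: "hd xs = hd B" "hd ys = last S"
    and count: "\<And>a b. a \<in> {1..n} \<Longrightarrow> b \<in> {1..n} \<Longrightarrow> a \<noteq> b \<Longrightarrow>
      wt (orbit_step a b) B + wt (orbit_step a b) S + 2 * orbit_col a b n 1 = r"
  shows "rainbow_cycle n r (xs @ ys)" "length (xs @ ys) = n * length (B @ S)"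
proof -
  note B = BS[unfolded segs_def] and R = r[unfolded rails_def]
  have n_eq: "Suc (n - 1) = n" using n2 by simp
  \<comment> \<open>Rotating the starts \<open>n\<close> times makes both closing edges instances of
    \<open>adj_link\<close> and \<open>step_link\<close>.\<close>
  have joins: "last xs = (rot ^^ (n - 1)) \<circ> last B" "hd ys = (rot ^^ Suc (n - 1)) \<circ> last S"
    "last ys = (rot ^^ (n - 1)) \<circ> hd S" "hd xs = (rot ^^ Suc (n - 1)) \<circ> hd B"
    using R heads unfolding n_eq rot_pow_n by simp_all
  show len: "length (xs @ ys) = n * length (B @ S)"
    using R n_eq by simp
  show "rainbow_cycle n r (xs @ ys)"
  proof (rule rainbow_cycleI)
    have "1 \<le> length (B @ S)" using B by (cases B) auto
    then have "2 * 1 \<le> n * length (B @ S)" using n2 by (intro mult_le_mono) auto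
    then show "2 \<le> length (xs @ ys)" using len by linarith
    show "set (xs @ ys) \<subseteq> Perms n" "distinct (xs @ ys)" using R by auto
    have "adj n (last xs) (hd ys)" "adj n (last ys) (hd xs)"
      unfolding joins by (rule adj_link, use B in blast)+
    then show "successively (adj n) (xs @ ys)" "adj n (last (xs @ ys)) (hd (xs @ ys))"
      using R by (auto simp: successively_append_iff)
    fix a b assume ab: "a \<in> {1..n}" "b \<in> {1..n}" "a \<noteq> b"
    let ?c = "\<lambda>i. col a b ((rot ^^ i) n) ((rot ^^ i) 1)"
    have "step a b (last xs) (hd ys) = ?c (n - 1)" "step a b (last ys) (hd xs) = ?c (n - 1)"
      unfolding joins by (rule step_link, use B in blast, rule segs_permutes[OF BS])+
    then have "wt (step a b) (xs @ ys) + step a b (last (xs @ ys)) (hd (xs @ ys))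
        = (wt (step a b) xs + wt (step a b) ys) + 2 * ?c (n - 1)"
      using R by (simp add: wt_append)
    also have "\<dots> = (\<Sum>i\<le>n - 1. wt (step a b) (lift i B) + wt (step a b) (lift i S)) +
        (\<Sum>i<Suc (n - 1). 2 * ?c i)"
      using R by simp
    also have "\<dots> = wt (orbit_step a b) B + wt (orbit_step a b) S + 2 * orbit_col a b n 1"
      unfolding lessThan_Suc_atMost[symmetric] n_eq wt_orbit_step orbit_col_def sum_distrib_left
      by (simp add: sum.distrib)
    finally show "wt (step a b) (xs @ ys) + step a b (last (xs @ ys)) (hd (xs @ ys)) = r"
      using count[OF ab] by simp
  qed
qed

text \<open>This start serves odd \<open>n\<close>: the remaining \<open>n - 1\<close> copies then
  take an even number of steps.\<close>

lemma rails_odd: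
  assumes "segs B S"
  shows "rails B S 0 B (rev S)"
proof -
  note B = assms[unfolded segs_def]
  have "\<pi> \<in> Perms n \<and> \<pi> n = n" if "\<pi> \<in> set (B @ S)" for \<pi>
    using that B lift_in_Perms[of \<pi> 0] lift_n[of \<pi> 0] by auto
  then show ?thesis
    using B unfolding rails_def
    by (auto simp: successively_adj_rev last_rev lift_def wt_rev step_commute simp del: successively_rev)
qed

text \<open>One exchange of the opposite orientation: the cycle \<open>F @ G\<close> may differ from \<open>B @ S\<close>, and the
  second copy is cut between \<open>Q\<close> and \<open>P\<close> instead of between \<open>S\<close> and \<open>B\<close>.\<close>

lemma rails_even:
  assumes BS: "segs B S" and S: "S = Q @ P" "Q \<noteq> []" "P \<noteq> []"
    and F: "F \<noteq> []" "G \<noteq> []" "successively (adj n) F" "successively (adj n) G" "distinct (F @ G)"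
      "\<And>\<pi>. \<pi> \<in> set (F @ G) \<Longrightarrow> \<pi> permutes {1..n - 1}"
      "length (F @ G) = length (B @ S)"
    and links: "transpose n 1 \<circ> last F = rot \<circ> hd P" "transpose n 1 \<circ> hd G = rot \<circ> last Q"
    and turn: "hd B = transpose 1 2 \<circ> last S"
    and count: "\<And>a b. wt (step a b) F + wt (step a b) G + wt (step a b) (lift 1 Q)
        + wt (step a b) (lift 1 P) + col a b (rot 1) (rot 2)
      = wt (step a b) B + wt (step a b) S + wt (step a b) (lift 1 S)"
  shows "rails B S 1 (F @ lift 1 (P @ B)) (rev G @ lift 1 (rev Q))"
proof -
  note B = BS[unfolded segs_def]
  have bij: "bij (last F)" "bij (hd G)" "bij (last S)"
  proof -
    have "last F permutes {1..n - 1}" "hd G permutes {1..n - 1}" "last S permutes {1..n - 1}"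
      using F B by auto
    then show "bij (last F)" "bij (hd G)" "bij (last S)" using permutes_bij by blast+
  qed
  \<comment> \<open>Copy 1 is cut between \<open>Q\<close> and \<open>P\<close>, so its edge from
    the end of \<open>S\<close> to the start of \<open>B\<close> survives and is traversed between
    \<open>P\<close> and \<open>B\<close>.\<close>
  have turn_adj: "adj n (last P) (hd B)"
    using turn S n2 by (intro adjI[of 1 n 2]) auto
  have join: "adj n (last F) ((rot ^^ 1) \<circ> hd P)" "adj n (hd G) ((rot ^^ 1) \<circ> last Q)"
    using adj_link[OF links(1), of 0] adj_link[OF links(2), of 0] by simp_all
  have cost: "step a b (last F) ((rot ^^ 1) \<circ> hd P) = col a b n 1"
    "step a b (hd G) ((rot ^^ 1) \<circ> last Q) = col a b n 1" for a b
    using step_link[OF links(1) bij(1), of a b 0] step_link[OF links(2) bij(2), of a b 0] by simp_all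
  have turn_cost: "step a b ((rot ^^ 1) \<circ> last P) ((rot ^^ 1) \<circ> hd B) = col a b (rot 1) (rot 2)" for a b
    using step_lift[OF bij(3), of a b 1 1 2] turn S by simp
  have suc_PB: "successively (adj n) (P @ B)" "successively (adj n) Q"
    using B S turn_adj by (auto simp: successively_append_iff)
  have suc: "successively (adj n) (F @ lift 1 (P @ B))" "successively (adj n) (rev G @ lift 1 (rev Q))"
    using F S join suc_PB successively_lift[of "P @ B" 1] successively_lift[of "rev Q" 1]
    by (auto simp: successively_append_iff successively_adj_rev hd_lift last_lift hd_rev last_rev hd_append
        simp del: successively_rev)
  have low: "\<pi> \<in> Perms n \<and> \<pi> n = (rot ^^ 0) n" if "\<pi> \<in> set (F @ G)" for \<pi>
    using F(6)[OF that] lift_in_Perms[of \<pi> 0] lift_n[of \<pi> 0] by auto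
  have high: "\<pi> \<in> Perms n \<and> \<pi> n = (rot ^^ 1) n" if "\<pi> \<in> set (lift 1 (B @ Q @ P))" for \<pi>
    using that B S lift_in_Perms[of _ 1] lift_n[of _ 1] by (fastforce simp: set_lift)
  have "(rot ^^ 0) n \<noteq> (rot ^^ 1) n"
    using rot_pow_n_inj[of 0 1] n2 by auto
  then have "set (F @ G) \<inter> set (lift 1 (B @ Q @ P)) = {}"
    using low high by fastforce
  moreover have "distinct (lift 1 (B @ Q @ P))" using B S by (intro distinct_lift) simp
  ultimately have dist: "distinct ((F @ lift 1 (P @ B)) @ rev G @ lift 1 (rev Q))"
    using F by auto
  have mem: "\<forall>\<pi>\<in>set ((F @ lift 1 (P @ B)) @ rev G @ lift 1 (rev Q)).
      \<pi> \<in> Perms n \<and> (\<exists>i\<le>1. \<pi> n = (rot ^^ i) n)"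
  proof
    fix \<pi> assume "\<pi> \<in> set ((F @ lift 1 (P @ B)) @ rev G @ lift 1 (rev Q))"
    then have "\<pi> \<in> set (F @ G) \<or> \<pi> \<in> set (lift 1 (B @ Q @ P))" by auto
    then show "\<pi> \<in> Perms n \<and> (\<exists>i\<le>1. \<pi> n = (rot ^^ i) n)"
      using low high zero_le_one order_refl by metis
  qed
  have wt: "wt (step a b) (F @ lift 1 (P @ B)) + wt (step a b) (rev G @ lift 1 (rev Q)) =
       (\<Sum>i\<le>1. wt (step a b) (lift i B) + wt (step a b) (lift i S)) +
       (\<Sum>i<1. 2 * col a b ((rot ^^ i) n) ((rot ^^ i) 1))" for a b
  proof -
    have "wt (step a b) (F @ lift 1 (P @ B)) =
        wt (step a b) F + col a b n 1 + wt (step a b) (lift 1 P) + col a b (rot 1) (rot 2) + wt (step a b) (lift 1 B)"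
      using F S B cost[of a b] turn_cost[of a b] by (simp add: wt_append hd_lift last_lift hd_append)
    moreover have "wt (step a b) (rev G @ lift 1 (rev Q)) =
        wt (step a b) G + col a b n 1 + wt (step a b) (lift 1 Q)"
      using F S cost[of a b] by (simp add: wt_append hd_rev last_rev last_lift wt_rev step_commute)
    moreover have "lift 0 xs = xs" for xs by (simp add: lift_def)
    ultimately show ?thesis using count[of a b] by simp
  qed
  show ?thesis
    unfolding rails_def using B F S dist mem wt suc by (simp add: last_lift last_rev hd_lift)
qed

end

subsection \<open>Hamiltonian cycles by swaps of adjacent values\<close>

definition nbr :: "nat \<Rightarrow> (nat \<Rightarrow> nat) \<Rightarrow> (nat \<Rightarrow> nat) \<Rightarrow> bool" where
  "nbr k \<tau> \<tau>' \<longleftrightarrow> (\<exists>v\<in>{2..k}. \<tau>' = transpose v (Suc v) \<circ> \<tau>)"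

text \<open>A Hamiltonian cycle, since \<open>fact k\<close> distinct permutations of {2..Suc k} are
  all of them. For k = 2 it goes back and forth along one edge.\<close>

definition swap_cycle :: "nat \<Rightarrow> (nat \<Rightarrow> nat) list \<Rightarrow> bool" where
  "swap_cycle k T \<longleftrightarrow> T \<noteq> [] \<and> successively (nbr k) T \<and> nbr k (last T) (hd T) \<and> distinct T \<and>
     length T = fact k \<and> (\<forall>\<tau>\<in>set T. \<tau> permutes {2..Suc k})"

lemma nbrI: "2 \<le> v \<Longrightarrow> v \<le> k \<Longrightarrow> \<tau>' = transpose v (Suc v) \<circ> \<tau> \<Longrightarrow> nbr k \<tau> \<tau>'"
  by (auto simp: nbr_def)

lemma nbr_commute: "nbr k \<tau> \<tau>' \<Longrightarrow> nbr k \<tau>' \<tau>"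
  unfolding nbr_def by (subst transpose_comp_flip)

lemma nbr_Suc: "nbr k \<tau> \<tau>' \<Longrightarrow> nbr (Suc k) \<tau> \<tau>'"
  by (auto simp: nbr_def intro: le_SucI)

lemma swap_cycle_rotate: "swap_cycle k (xs @ ys) \<Longrightarrow> ys \<noteq> [] \<Longrightarrow> swap_cycle k (ys @ xs)"
  by (cases "xs = []") (auto simp: swap_cycle_def successively_append_iff)

text \<open>On inverse words, \<open>sink k j\<close> moves the new letter \<open>k + 2\<close> from the last position \<open>j\<close> places to the left.\<close>

definition sink :: "nat \<Rightarrow> nat \<Rightarrow> nat \<Rightarrow> nat" where
  "sink k j x = (if x = k + 2 then k + 2 - j else if k + 2 - j \<le> x \<and> x \<le> k + 1 then Suc x else x)"

definition down :: "nat \<Rightarrow> (nat \<Rightarrow> nat) \<Rightarrow> (nat \<Rightarrow> nat) list" where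
  "down k \<tau> = map (\<lambda>j. sink k j \<circ> \<tau>) [0..<Suc k]"

lemma sink_0: "sink k 0 = id"
  by (auto simp: sink_def)

lemma sink_Suc: "j < k \<Longrightarrow> sink k (Suc j) = transpose (k + 1 - j) (Suc (k + 1 - j)) \<circ> sink k j"
  by (auto simp: sink_def transpose_def fun_eq_iff)

lemma sink_permutes: "j \<le> k \<Longrightarrow> sink k j permutes {2..k + 2}"
proof (induction j)
  case 0
  show ?case by (simp only: sink_0 permutes_id)
next
  case (Suc j)
  then have "transpose (k + 1 - j) (Suc (k + 1 - j)) permutes {2..k + 2}"
    by (intro permutes_swap_id) auto
  moreover have "sink k (Suc j) = transpose (k + 1 - j) (Suc (k + 1 - j)) \<circ> sink k j"
    using Suc.prems by (intro sink_Suc) simp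
  ultimately show ?case
    using Suc permutes_compose by (metis Suc_leD)
qed

text \<open>Full sinking raises the values 2, ..., k + 1 by one, so a swap of adjacent values at the
  near end appears at the far end as a swap of the adjacent values one higher.\<close>

lemma sink_transpose:
  assumes "2 \<le> v" "v \<le> k"
  shows "sink k k \<circ> transpose v (Suc v) = transpose (Suc v) (Suc (Suc v)) \<circ> sink k k"
proof -
  have "bij (sink k k)" using sink_permutes permutes_bij by blast
  moreover have "sink k k v = Suc v" "sink k k (Suc v) = Suc (Suc v)"
    using assms by (auto simp: sink_def)
  ultimately show ?thesis by (simp add: comp_transpose)
qed

lemma down_nonempty [simp]: "down k \<tau> \<noteq> []"
  by (simp add: down_def)

lemma length_down [simp]: "length (down k \<tau>) = Suc k"
  by (simp add: down_def)

lemma hd_down: "hd (down k \<tau>) = \<tau>"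
  by (simp add: down_def hd_map sink_0 del: upt_Suc)

lemma last_down: "last (down k \<tau>) = sink k k \<circ> \<tau>"
  by (simp add: down_def)

lemma set_down: "set (down k \<tau>) = (\<lambda>j. sink k j \<circ> \<tau>) ` {..k}"
  by (auto simp: down_def simp del: upt_Suc)

lemma sink_inj:
  assumes "\<tau> permutes {2..Suc k}" "\<tau>' permutes {2..Suc k}" "sink k j \<circ> \<tau> = sink k j' \<circ> \<tau>'"
    "j \<le> k" "j' \<le> k"
  shows "j = j'" "\<tau> = \<tau>'"
proof -
  have "\<tau> (k + 2) = k + 2" "\<tau>' (k + 2) = k + 2"
    using assms by (auto simp: permutes_not_in)
  then have "k + 2 - j = k + 2 - j'"
    using fun_cong[OF assms(3), of "k + 2"] by (simp add: sink_def)
  then show "j = j'" using assms by simp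
  then have "sink k j (\<tau> x) = sink k j (\<tau>' x)" for x
    using fun_cong[OF assms(3), of x] by simp
  moreover have "inj (sink k j)"
    using sink_permutes[OF assms(4)] permutes_inj by blast
  ultimately show "\<tau> = \<tau>'" by (auto simp: fun_eq_iff inj_eq)
qed

text \<open>This is the Steinhaus-Johnson-Trotter scheme: the new letter sweeps to and fro, and one
  step of \<open>T\<close> is made at each turn. Since \<open>T\<close> has even length, the walk
  both starts and ends with the letter fully sunk, and can be closed there.\<close>

lemma swap_cycle_extend:
  assumes T: "swap_cycle k T" and k: "2 \<le> k"
  shows "swap_cycle (Suc k) (snake (\<lambda>\<tau>. rev (down k \<tau>)) T)"
proof -
  let ?f = "\<lambda>\<tau>. rev (down k \<tau>)"
  note T' = T[unfolded swap_cycle_def]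
  have perm: "\<tau> permutes {2..Suc k}" if "\<tau> \<in> set T" for \<tau> using T' that by blast
  have even_len: "even (length T)" using T' k by (simp add: dvd_fact)
  have joins: "nbr (Suc k) (hd (?f \<tau>)) (hd (?f \<tau>'))" "nbr (Suc k) (last (?f \<tau>)) (last (?f \<tau>'))"
    if "nbr k \<tau> \<tau>'" for \<tau> \<tau>'
  proof -
    obtain v where v: "2 \<le> v" "v \<le> k" "\<tau>' = transpose v (Suc v) \<circ> \<tau>"
      using \<open>nbr k \<tau> \<tau>'\<close> by (auto simp: nbr_def)
    have "sink k k \<circ> \<tau>' = transpose (Suc v) (Suc (Suc v)) \<circ> (sink k k \<circ> \<tau>)"
      using sink_transpose[OF v(1,2)] v(3) by (metis comp_assoc)
    then show "nbr (Suc k) (hd (?f \<tau>)) (hd (?f \<tau>'))"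
      using v unfolding hd_rev last_down by (intro nbrI[of "Suc v"]) auto
    show "nbr (Suc k) (last (?f \<tau>)) (last (?f \<tau>'))"
      using nbr_Suc[OF that] by (simp add: last_rev hd_down)
  qed
  have inner: "successively (nbr (Suc k)) (?f \<tau>)" for \<tau>
  proof -
    have "nbr (Suc k) (sink k j \<circ> \<tau>) (sink k (Suc j) \<circ> \<tau>)" if "j < k" for j
      using that by (intro nbrI[of "k + 1 - j"]) (auto simp: sink_Suc comp_assoc)
    then have "successively (nbr (Suc k)) (down k \<tau>)"
      by (auto simp: successively_conv_nth down_def simp del: upt_Suc)
    then show ?thesis
      unfolding successively_rev by (rule successively_mono) (rule nbr_commute)
  qed
  have "successively (nbr (Suc k)) (snake ?f T)"
    using T' inner joins nbr_commute by (intro successively_snake[of _ "nbr k"]) auto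
  moreover have "distinct (snake ?f T)"
  proof (rule distinct_snake)
    show "distinct (?f \<tau>)" if "\<tau> \<in> set T" for \<tau>
      using sink_inj(1)[OF perm[OF that] perm[OF that]]
      by (auto simp: down_def distinct_map inj_on_def simp del: upt_Suc)
    show "set (?f \<tau>) \<inter> set (?f \<tau>') = {}" if "\<tau> \<in> set T" "\<tau>' \<in> set T" "\<tau> \<noteq> \<tau>'" for \<tau> \<tau>'
      using sink_inj(2)[OF perm[OF that(1)] perm[OF that(2)]] that(3) by (auto simp: set_down)
  qed (use T' in blast)
  moreover have "length (snake ?f T) = fact (Suc k)"
    using length_snake[of ?f "Suc k" T] T' by simp
  moreover have "\<pi> permutes {2..Suc (Suc k)}" if "\<pi> \<in> set (snake ?f T)" for \<pi>
  proof -
    obtain \<tau> j where \<tau>: "\<tau> \<in> set T" "j \<le> k" "\<pi> = sink k j \<circ> \<tau>"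
      using \<open>\<pi> \<in> set (snake ?f T)\<close> by (auto simp: set_snake set_down)
    have "\<tau> permutes {2..Suc (Suc k)}" using perm[OF \<tau>(1)] by (rule permutes_subset) auto
    then show ?thesis using \<tau> sink_permutes[of j k] permutes_compose by auto
  qed
  moreover have "nbr (Suc k) (last (snake ?f T)) (hd (snake ?f T))"
    using T' even_len joins(1)[of "last T" "hd T"] by (simp add: last_snake hd_snake)
  moreover have "snake ?f T \<noteq> []" using T' by (simp add: snake_eq_Nil)
  ultimately show ?thesis by (simp add: swap_cycle_def)
qed

lemma swap_cycle_2: "swap_cycle 2 [id, transpose 2 3]"
proof -
  have "id \<noteq> transpose 2 (3 :: nat)" by (metis id_apply transpose_apply_first numeral_eq_iff num.distinct(5) semiring_norm(89))
  moreover have "nbr 2 id (transpose 2 3)" by (rule nbrI[of 2]) auto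
  moreover have "transpose 2 3 permutes {2..Suc 2 :: nat}" by (rule permutes_swap_id) auto
  moreover have "id permutes {2..Suc 2 :: nat}" by (rule permutes_id)
  ultimately show ?thesis
    by (simp add: swap_cycle_def nbr_commute fact_numeral)
qed

text \<open>The second pair provides the exchange of opposite orientation for even \<open>n\<close>. It has to start at an
  even index, so that it is traversed between the far ends of two tiles.\<close>

lemma swap_cycle_exists:
  assumes "3 \<le> k"
  shows "\<exists>R R'. even (length R) \<and> swap_cycle k ([id, transpose 2 3] @ R @
    [transpose 3 4 \<circ> transpose 2 3, transpose 2 3 \<circ> (transpose 3 4 \<circ> transpose 2 3)] @ R')"
  using assms
proof (induction k rule: dec_induct)
  case base
  let ?s = "transpose 2 (3::nat)" and ?t = "transpose 3 (4::nat)"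
  have down: "down 2 \<tau> = [\<tau>, ?t \<circ> \<tau>, ?s \<circ> (?t \<circ> \<tau>)]" for \<tau>
    using sink_Suc[of 0 2] sink_Suc[of 1 2]
    by (simp add: down_def sink_0 upt_rec comp_assoc numeral_2_eq_2 numeral_3_eq_3 eval_nat_numeral)
  have "swap_cycle 3 (snake (\<lambda>\<tau>. rev (down 2 \<tau>)) [id, ?s])"
    using swap_cycle_extend[OF swap_cycle_2] by simp
  then have "swap_cycle 3 ([?s \<circ> ?t, ?t] @ [id, ?s, ?t \<circ> ?s, ?s \<circ> (?t \<circ> ?s)])"
    by (simp add: down)
  from swap_cycle_rotate[OF this]
  have "swap_cycle 3 ([id, ?s] @ [] @ [?t \<circ> ?s, ?s \<circ> (?t \<circ> ?s)] @ [?s \<circ> ?t, ?t])"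
    by simp
  moreover have "even (length [])" by simp
  ultimately show ?case by blast
next
  case (step k)
  let ?s = "transpose 2 (3::nat)" and ?c = "transpose 3 (4::nat) \<circ> transpose 2 3"
  obtain R R' where R: "even (length R)" "swap_cycle k ([id, ?s] @ R @ [?c, ?s \<circ> ?c] @ R')"
    using step.IH by blast
  let ?f = "\<lambda>\<tau>. rev (down k \<tau>)"
  define tl_down where "tl_down \<tau> = tl (down k \<tau>)" for \<tau>
  have down: "down k \<tau> = \<tau> # tl_down \<tau>" for \<tau>
    unfolding tl_down_def by (metis down_nonempty hd_down list.collapse)
  have "swap_cycle (Suc k) (snake ?f ([id, ?s] @ R @ [?c, ?s \<circ> ?c] @ R'))"
    using R(2) step.hyps by (intro swap_cycle_extend) auto
  \<comment> \<open>Blocks of even index are read backwards, end at their own permutation, and are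
    followed by a block starting at its own. Thus both pairs stay adjacent: \<open>id\<close> has
    index 0, and the index of \<open>?c\<close> is even because \<open>R\<close> has even
    length.\<close>
  also have "snake ?f ([id, ?s] @ R @ [?c, ?s \<circ> ?c] @ R') =
    rev (tl_down id) @ ([id, ?s] @ (tl_down ?s @ snake ?f R @ rev (tl_down ?c)) @
      [?c, ?s \<circ> ?c] @ (tl_down (?s \<circ> ?c) @ snake ?f R'))"
    using R(1) by (simp add: snake_append down)
  finally have "swap_cycle (Suc k) \<dots>" .
  from swap_cycle_rotate[OF this]
  have "swap_cycle (Suc k) ([id, ?s] @ (tl_down ?s @ snake ?f R @ rev (tl_down ?c)) @
      [?c, ?s \<circ> ?c] @ (tl_down (?s \<circ> ?c) @ snake ?f R' @ rev (tl_down id)))"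
    by simp
  \<comment> \<open>The pieces have lengths \<open>k\<close>, \<open>Suc k * length R\<close> and
    \<open>k\<close>.\<close>
  moreover have "even (length (tl_down ?s @ snake ?f R @ rev (tl_down ?c)))"
    using R(1) length_snake[of ?f "Suc k" R] by (simp add: tl_down_def)
  ultimately show ?case by blast
qed

subsection \<open>The rainbow cycles\<close>

context gray
begin

text \<open>The closed walk starts with \<open>tile id\<close>; moving its first word
  \<open>id\<close> to the end leaves \<open>tl (tile id)\<close> and \<open>tail R\<close> in the
  roles of \<open>B\<close> and \<open>S\<close>.\<close>

definition tail :: "(nat \<Rightarrow> nat) list \<Rightarrow> (nat \<Rightarrow> nat) list" where
  "tail R = snake (\<lambda>\<tau>. rev (tile \<tau>)) R @ [id]"

lemma tile_id: "3 \<le> n \<Longrightarrow> tile id = id # tl (tile id)"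
  by (metis tile_nonempty hd_tile list.collapse)

lemma tl_tile_id:
  assumes "3 \<le> n"
  shows "tl (tile id) \<noteq> []" "hd (tl (tile id)) = lam 1" "last (tl (tile id)) = lam (n - 2)"
proof -
  have "tl (tile id) = map lam [1..<n - 1]"
    using assms by (simp add: tile_def map_tl[symmetric] id_comp)
  then show "tl (tile id) \<noteq> []" "hd (tl (tile id)) = lam 1" "last (tl (tile id)) = lam (n - 2)"
    using assms by (simp_all add: hd_map last_map numeral_2_eq_2)
qed

text \<open>A swap of values applied to the index of a tile acts alike on all its words, so
  neighbouring tiles can be joined at either end.\<close>

lemma nbr_tile:
  assumes "nbr k \<tau> \<tau>'" "k + 2 \<le> n"
  shows "adj n (hd (tile \<tau>)) (hd (tile \<tau>'))" "adj n (last (tile \<tau>)) (last (tile \<tau>'))"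
    and "bij \<tau> \<Longrightarrow> orbit_step a b (hd (tile \<tau>)) (hd (tile \<tau>')) = orbit_col a b n 1"
    and "bij \<tau> \<Longrightarrow> orbit_step a b (last (tile \<tau>)) (last (tile \<tau>')) = orbit_col a b n 1"
proof -
  obtain v where v: "2 \<le> v" "v \<le> k" "\<tau>' = transpose v (Suc v) \<circ> \<tau>"
    using assms by (auto simp: nbr_def)
  show "adj n (hd (tile \<tau>)) (hd (tile \<tau>'))" "adj n (last (tile \<tau>)) (last (tile \<tau>'))"
    using v assms by (auto simp: hd_tile last_tile intro!: adjI[of v n "Suc v"])
  have col: "orbit_col a b v (Suc v) = orbit_col a b n 1"
    using v assms by (intro orbit_col_adjacent) auto
  show "bij \<tau> \<Longrightarrow> orbit_step a b (hd (tile \<tau>)) (hd (tile \<tau>')) = orbit_col a b n 1"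
    unfolding hd_tile v(3) using orbit_step_transpose col by metis
  assume "bij \<tau>"
  then have "bij (\<tau> \<circ> lam (n - 2))" using bij_lam bij_comp by blast
  then show "orbit_step a b (last (tile \<tau>)) (last (tile \<tau>')) = orbit_col a b n 1"
    unfolding last_tile v(3) comp_assoc using orbit_step_transpose col by metis
qed

text \<open>The cycle is cut at the edge from \<open>id\<close> to \<open>lam 1\<close>, of color
  (1, 2), and at the edge of color (2, 3) that leaves \<open>lam (n - 2)\<close>. Rotating the first
  color gives the second, which permits the exchange between consecutive copies. For the count,
  \<open>fact k\<close> tiles and as many joins give \<open>2 * fact k\<close>, and the two cut
  edges are replaced by two swaps from the same orbit.\<close>

lemma
  assumes T: "swap_cycle k (id # transpose 2 3 # R)" and k: "2 \<le> k" "k + 2 \<le> n"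
  shows segs_tiles: "segs (tl (tile id)) (tail (transpose 2 3 # R))" (is "segs ?B ?S")
    and wt_tiles: "\<And>a b. a \<in> {1..n} \<Longrightarrow> b \<in> {1..n} \<Longrightarrow> a \<noteq> b \<Longrightarrow>
      wt (orbit_step a b) (tl (tile id)) + wt (orbit_step a b) (tail (transpose 2 3 # R))
        + 2 * orbit_col a b n 1 = 2 * fact k"
    and length_tiles: "length (tl (tile id) @ tail (transpose 2 3 # R)) = (n - 1) * fact k"
proof -
  let ?s = "transpose 2 (3::nat)"
  let ?f = "\<lambda>\<tau>. rev (tile \<tau>)"
  note T' = T[unfolded swap_cycle_def]
  have n: "4 \<le> n" using k by simp
  have perm: "\<tau> permutes {2..n - 1}" if "\<tau> \<in> set (id # ?s # R)" for \<tau>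
  proof -
    have "\<tau> permutes {2..Suc k}" using T' that by blast
    then show ?thesis by (rule permutes_subset) (use k in auto)
  qed
  have len: "Suc (length (?s # R)) = fact k" using T' by simp
  have "even (fact k :: nat)" using k by (simp add: dvd_fact)
  \<comment> \<open>By this parity the last tile is read backwards and ends at its index, a
    neighbour of \<open>id\<close>.\<close>
  then have odd_len: "odd (length (?s # R))" using len by (metis even_Suc)
  have tile_id: "tile id = id # ?B" using n by (intro tile_id) simp
  note B = tl_tile_id[of, OF order_trans[OF _ n], simplified]
  have snake_id: "snake tile (id # ?s # R) = id # ?B @ snake ?f (?s # R)"
    using tile_id by simp
  have snake_ne: "snake ?f (?s # R) \<noteq> []" by simp
  have ends: "hd ?S = ?s \<circ> lam (n - 2)" "last (snake ?f (?s # R)) = last (?s # R)" "last ?S = id"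
    using odd_len last_snake[of ?f "?s # R"] by (auto simp: tail_def hd_append hd_rev last_rev last_tile hd_tile)
  have closed: "nbr k (last (?s # R)) id" using T' by simp
  have suc_T: "successively (nbr k) (?s # R)" using T' by simp
  have suc: "successively (adj n) (snake tile (id # ?s # R))"
    using T' nbr_tile(1,2)[OF _ k(2)] adj_commute successively_tile perm
    by (intro successively_snake[of _ "nbr k"]) auto
  have dist: "distinct (snake tile (id # ?s # R))"
    using T' perm by (intro distinct_snake tile_disjoint distinct_tile) auto
  show "segs ?B ?S"
    unfolding segs_def
  proof (intro conjI ballI)
    show "?B \<noteq> []" "?S \<noteq> []" using B by (auto simp: tail_def)
    show "successively (adj n) ?B"
      using suc B by (simp only: snake_id successively_Cons successively_append_iff append_is_Nil_conv) simp
    have "adj n (last (?s # R)) id" using nbr_tile(1)[OF closed k(2)] by (simp add: hd_tile)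
    then show "successively (adj n) ?S"
      unfolding tail_def using suc B ends(2) snake_ne
      by (simp only: snake_id successively_Cons successively_append_iff) simp
    show "distinct (?B @ ?S)"
      using dist unfolding snake_id tail_def by auto
    show "\<pi> permutes {1..n - 1}" if \<pi>: "\<pi> \<in> set (?B @ ?S)" for \<pi>
    proof -
      have "set (?B @ ?S) = set (snake tile (id # ?s # R))"
        unfolding snake_id tail_def by (simp only: set_append set_simps) blast
      then obtain \<tau> where "\<tau> \<in> set (id # ?s # R)" "\<pi> \<in> set (tile \<tau>)"
        using \<pi> unfolding set_snake by blast
      then show ?thesis using perm tile_permutes by blast
    qed
    show "transpose n 1 \<circ> last ?B = rot \<circ> last ?S"
      using B ends transpose_lam by simp
    \<comment> \<open>(2, 3) commutes with (n, 1), and becomes (1, 2) when moved to the right of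
      \<open>rot\<close>.\<close>
    have "transpose n 1 \<circ> (?s \<circ> lam (n - 2)) = ?s \<circ> (transpose n 1 \<circ> lam (n - 2))"
      using n by (auto simp: transpose_def fun_eq_iff)
    also have "\<dots> = rot \<circ> lam 1"
      using comp_transpose[OF bij_rot_pow[of 1], of 1 2] n
      by (simp only: transpose_lam lam_1) (simp add: rot_Suc eval_nat_numeral)
    finally show "transpose n 1 \<circ> hd ?S = rot \<circ> hd ?B" using B ends by simp
  qed
  show "wt (orbit_step a b) ?B + wt (orbit_step a b) ?S + 2 * orbit_col a b n 1 = 2 * fact k"
    if ab: "a \<in> {1..n}" "b \<in> {1..n}" "a \<noteq> b" for a b
  proof -
    let ?A = "orbit_col a b n 1" and ?h = "orbit_step a b"
    have tile: "wt ?h (tile \<tau>) + ?A = 2" if "\<tau> \<in> set (id # ?s # R)" for \<tau>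
      using wt_orbit_tile[OF ab perm[OF that]] .
    have first: "?h id (lam 1) = ?A"
    proof -
      have "orbit_col a b 1 2 = ?A" using orbit_col_adjacent[of 1 a b] n by (simp add: numeral_2_eq_2)
      then show ?thesis unfolding lam_1 using orbit_step_transpose[of id a b 1 2] by simp
    qed
    have "wt ?h (tile id) = ?h id (lam 1) + wt ?h ?B"
      using B by (subst tile_id) (simp add: wt_Cons)
    then have wt_B: "wt ?h ?B + 2 * ?A = 2"
      using tile[of id] first by simp
    have bij: "bij \<tau>" if "\<tau> \<in> set (id # ?s # R)" for \<tau>
      using perm[OF that] permutes_bij by blast
    \<comment> \<open>The truncated subtraction is exact, since \<open>tile\<close> bounds
      \<open>?A\<close> by 2.\<close>
    have "wt ?h (snake ?f (?s # R)) + ?A = length (?s # R) * ((2 - ?A) + ?A)"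
    proof (rule wt_snake[OF _ suc_T])
      show "wt ?h (?f \<tau>) = 2 - ?A" if "\<tau> \<in> set (?s # R)" for \<tau>
        using tile[of \<tau>] that by (simp add: wt_rev orbit_step_commute)
      show "?h (hd (?f \<tau>)) (hd (?f \<tau>')) = ?A \<and> ?h (last (?f \<tau>)) (last (?f \<tau>')) = ?A"
        if "\<tau> \<in> set (?s # R)" "\<tau>' \<in> set (?s # R)" "nbr k \<tau> \<tau>'" for \<tau> \<tau>'
        using nbr_tile(3,4)[OF that(3) k(2) bij] that(1) by (simp add: hd_rev last_rev)
    qed (auto simp: orbit_step_commute)
    moreover have "?h (last (?s # R)) id = ?A"
      using nbr_tile(3)[OF closed k(2) bij] by (simp add: hd_tile)
    then have "wt ?h ?S = wt ?h (snake ?f (?s # R)) + ?A"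
      unfolding tail_def by (subst wt_append) (use ends(2) snake_ne in \<open>simp_all del: snake.simps\<close>)
    moreover have "(2 - ?A) + ?A = 2" using tile[of id] by simp
    ultimately have "wt ?h ?S + 2 = Suc (length (?s # R)) * 2" by simp
    then show ?thesis using wt_B unfolding len by simp
  qed
  have "Suc (length (?B @ snake ?f (?s # R))) = (n - 1) * fact k"
    using length_snake[of tile "n - 1" "id # ?s # R"] T' by (simp only: snake_id) simp
  then show "length (?B @ ?S) = (n - 1) * fact k" by (simp add: tail_def)
qed

lemma rot_swap:
  assumes "1 \<le> v" "Suc v < n"
  shows "rot \<circ> transpose v (Suc v) = transpose (Suc v) (Suc (Suc v)) \<circ> rot"
  using comp_transpose[OF bij_rot_pow[of 1], of v "Suc v"] assms by (simp add: rot_Suc)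

text \<open>Fixing 1 and n, \<tau> commutes with (n, 1), which reduces the claim to
  \<open>transpose_lam\<close>.\<close>

lemma transpose_comp_lam:
  assumes "\<tau> n = n" "\<tau> 1 = 1" "bij \<tau>"
  shows "transpose n 1 \<circ> (\<tau> \<circ> lam (n - 2)) = \<tau> \<circ> rot"
proof -
  have "transpose n 1 \<circ> \<tau> = \<tau> \<circ> transpose n 1"
    using comp_transpose[OF assms(3), of n 1] assms by simp
  then show ?thesis using transpose_lam by (metis comp_assoc)
qed

lemma cycle_from_rails:
  assumes T: "swap_cycle k (id # transpose 2 3 # R)" and k: "2 \<le> k" "k + 2 \<le> n"
    and r: "rails (tl (tile id)) (tail (transpose 2 3 # R)) j xs ys" "j + 2 * t = n - 1"
    and heads: "hd xs = lam 1" "hd ys = id"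
  shows "\<exists>zs. rainbow_cycle n (2 * fact k) zs \<and> length zs = n * ((n - 1) * fact k)"
proof -
  let ?B = "tl (tile id)" and ?S = "tail (transpose 2 3 # R)"
  note BS = segs_tiles[OF T k]
  have "j + 2 * t < n" using r(2) n2 by simp
  then obtain xs' ys' where xs': "rails ?B ?S (n - 1) xs' ys'" "hd xs' = hd xs" "hd ys' = hd ys"
    using rails_complete[OF BS r(1), of t] r(2) by auto
  have "hd ?B = lam 1" using tl_tile_id k by simp
  then have heads': "hd xs' = hd ?B" "hd ys' = last ?S"
    using xs' heads by (auto simp: tail_def)
  show ?thesis
    using rails_close[OF BS xs'(1) heads' wt_tiles[OF T k]] length_tiles[OF T k] by auto
qed

section \<open>The cycles for odd and for even n\<close>

lemma rainbow_odd:
  assumes k: "2 \<le> k" "k + 2 \<le> n" and "odd n" and T: "swap_cycle k (id # transpose 2 3 # R)"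
  shows "\<exists>zs. rainbow_cycle n (2 * fact k) zs \<and> length zs = n * ((n - 1) * fact k)"
proof (rule cycle_from_rails[OF T k rails_odd[OF segs_tiles[OF T k]]])
  show "0 + 2 * ((n - 1) div 2) = n - 1" using \<open>odd n\<close> by simp
  show "hd (tl (tile id)) = lam 1" using tl_tile_id k by simp
qed (simp add: tail_def)

lemma even_complement: "even n \<Longrightarrow> 1 + 2 * ((n - 2) div 2) = n - 1"
  using n2 by presburger

text \<open>Copy 0 keeps its edge between \<open>B\<close> and \<open>S\<close> and is cut between
  the far ends of the tiles of \<open>?c\<close> and \<open>?s \<circ> ?c\<close> instead; copy 1 is
  cut inside the tile of \<open>?s\<close>. Both of these cut edges have color (2, 3), the second
  one after rotation.\<close>

lemma rainbow_even:
  assumes k: "3 \<le> k" "k + 2 \<le> n" and "even n"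
  shows "\<exists>zs. rainbow_cycle n (2 * fact k) zs \<and> length zs = n * ((n - 1) * fact k)"
proof -
  let ?s = "transpose 2 (3::nat)" and ?c = "transpose 3 (4::nat) \<circ> transpose 2 3"
  let ?f = "\<lambda>\<tau>. rev (tile \<tau>)"
  obtain R R' where R: "even (length R)" "swap_cycle k ([id, ?s] @ R @ [?c, ?s \<circ> ?c] @ R')"
    using swap_cycle_exists[OF k(1)] by blast
  define U where "U = R @ [?c, ?s \<circ> ?c] @ R'"
  have T: "swap_cycle k (id # ?s # U)" using R(2) by (simp add: U_def)
  have k': "2 \<le> k" "k + 2 \<le> n" and n: "5 \<le> n" using k by auto
  let ?B = "tl (tile id)" and ?S = "tail (?s # U)"
  define S1 where "S1 = ?f ?s @ snake tile R @ tile ?c"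
  define G where "G = ?f (?s \<circ> ?c) @ snake tile R' @ [id]"
  define Q where "Q = rev (drop 2 (tile ?s))"
  define P where "P = [?s \<circ> lam 1, ?s \<circ> lam 0] @ snake tile U @ [id]"
  have BS: "segs ?B ?S" by (rule segs_tiles[OF T k'])
  note BS' = BS[unfolded segs_def]
  note B = tl_tile_id[of, OF order_trans[OF _ n], simplified]
  have S_S1: "?S = S1 @ G"
    using R(1) by (simp add: tail_def S1_def G_def U_def snake_append)
  have "[0..<n - 1] = 0 # 1 # [2..<n - 1]"
    using n by (simp add: upt_conv_Cons numeral_2_eq_2)
  then have tile_s: "tile ?s = [?s \<circ> lam 0, ?s \<circ> lam 1] @ map (\<lambda>j. ?s \<circ> lam j) [2..<n - 1]"
    by (simp add: tile_def)
  have S_Q: "?S = Q @ P"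
    by (simp add: tail_def Q_def P_def) (simp add: tile_s)
  have Q: "Q \<noteq> []" "last Q = ?s \<circ> lam 2"
    using n by (auto simp: Q_def tile_s last_rev hd_map)
  have S1: "S1 \<noteq> []" "hd S1 = ?s \<circ> lam (n - 2)" "last S1 = ?c \<circ> lam (n - 2)"
    by (auto simp: S1_def hd_append hd_rev last_tile)
  have G: "G \<noteq> []" "hd G = ?s \<circ> ?c \<circ> lam (n - 2)" "last G = id"
    by (auto simp: G_def hd_append hd_rev last_tile)
  have c_fix: "?c n = n" "?c 1 = 1" "bij ?c" "(?s \<circ> ?c) n = n" "(?s \<circ> ?c) 1 = 1" "bij (?s \<circ> ?c)"
    using n by (auto simp: transpose_def intro!: bij_comp)
  have swaps: "rot \<circ> transpose 1 2 = transpose 2 3 \<circ> rot" "rot \<circ> transpose 2 3 = transpose 3 4 \<circ> rot"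
    using rot_swap[of 1] rot_swap[of 2] n by (simp_all add: eval_nat_numeral)
  \<comment> \<open>This explains the choice of \<open>?c\<close>: it is the rotation of (2, 3)(1,
    2), so the link from the end of its tile arrives at the second word of the rotated tile of
    \<open>?s\<close>.\<close>
  have c_rot: "?c \<circ> rot = rot \<circ> (?s \<circ> lam 1)"
    unfolding lam_1 using swaps by (metis comp_assoc)
  have lam_2: "?s \<circ> lam 2 = transpose 1 2 \<circ> (?s \<circ> lam 1)"
    using tile_step[of ?s 1] by (simp add: numeral_2_eq_2 numeral_3_eq_3 transpose_def)
  have "rails ?B ?S 1 ((?B @ S1) @ lift 1 (P @ ?B)) (rev G @ lift 1 (rev Q))"
  proof (rule rails_even[OF BS S_Q Q(1)])
    show "P \<noteq> []" "?B @ S1 \<noteq> []" "G \<noteq> []" using S1 G by (auto simp: P_def)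
    have "adj n (last ?B) (hd S1)"
      unfolding B S1 using n by (intro adjI[of 2 n 3]) auto
    then show "successively (adj n) (?B @ S1)" "successively (adj n) G"
      using BS' S_S1 S1 by (auto simp: successively_append_iff)
    show "distinct ((?B @ S1) @ G)" "length ((?B @ S1) @ G) = length (?B @ ?S)"
      using BS' S_S1 by auto
    show "\<pi> permutes {1..n - 1}" if "\<pi> \<in> set ((?B @ S1) @ G)" for \<pi>
      using BS' that S_S1 by auto
    show "transpose n 1 \<circ> last (?B @ S1) = rot \<circ> hd P"
      using S1 c_rot transpose_comp_lam[OF c_fix(1-3)] by (simp add: P_def)
    have "?s \<circ> ?c \<circ> rot = transpose 2 3 \<circ> (rot \<circ> (?s \<circ> lam 1))"
      using c_rot by (simp only: comp_assoc)
    also have "\<dots> = rot \<circ> (?s \<circ> lam 2)"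
      unfolding lam_2 using swaps(1) by (metis comp_assoc)
    finally show "transpose n 1 \<circ> hd G = rot \<circ> last Q"
      using G Q transpose_comp_lam[OF c_fix(4-6)] by simp
    show "hd ?B = transpose 1 2 \<circ> last ?S"
      using B S_S1 G lam_1 by simp
    fix a b
    have "step a b (last ?B) (hd S1) = col a b 2 3"
      unfolding B S1 using bij_lam by (intro step_transpose)
    then have 1: "wt (step a b) (?B @ S1) = wt (step a b) ?B + col a b 2 3 + wt (step a b) S1"
      using B S1 by (simp add: wt_append)
    have "step a b (last S1) (hd G) = col a b 2 3"
      unfolding S1 G comp_assoc using bij_lam bij_comp c_fix by (intro step_transpose) (auto intro!: bij_comp)
    then have 2: "wt (step a b) ?S = wt (step a b) S1 + col a b 2 3 + wt (step a b) G"
      using S_S1 S1 G by (simp add: wt_append)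
    have "step a b ((rot ^^ 1) \<circ> (?s \<circ> lam 1)) ((rot ^^ 1) \<circ> (?s \<circ> lam 2)) = col a b (rot 1) (rot 2)"
      unfolding lam_2 using bij_lam step_lift[of "?s \<circ> lam 1" a b 1 1 2] by (simp add: bij_comp)
    then have "step a b (last (lift 1 Q)) (hd (lift 1 P)) = col a b (rot 1) (rot 2)"
      using Q by (simp add: last_lift hd_lift P_def step_commute)
    then have 3: "wt (step a b) (lift 1 ?S) = wt (step a b) (lift 1 Q) + col a b (rot 1) (rot 2) + wt (step a b) (lift 1 P)"
      using S_Q Q by (simp add: wt_append P_def)
    show "wt (step a b) (?B @ S1) + wt (step a b) G + wt (step a b) (lift 1 Q)
        + wt (step a b) (lift 1 P) + col a b (rot 1) (rot 2)
      = wt (step a b) ?B + wt (step a b) ?S + wt (step a b) (lift 1 ?S)"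
      using 1 2 3 by simp
  qed
  then show ?thesis
  proof (rule cycle_from_rails[OF T k'])
    \<comment> \<open>Copies 0 and 1 are covered already; the other \<open>n - 2\<close> take an
      even number of steps.\<close>
    show "1 + 2 * ((n - 2) div 2) = n - 1" using even_complement \<open>even n\<close> by simp
    show "hd ((?B @ S1) @ lift 1 (P @ ?B)) = lam 1" using B by simp
    show "hd (rev G @ lift 1 (rev Q)) = id" using G by (simp add: hd_append hd_rev)
  qed
qed

text \<open>With only two tiles the single cycle has no second exchange to offer, so the cycle in the first coset
  uses the swap \<open>(3, 4)\<close> instead of \<open>(2, 3)\<close>. The rotated swap \<open>(2, 3)\<close> of the second coset is also
  \<open>(3, 4)\<close>, which restores the balance.\<close>

lemma rainbow_even_2:
  assumes n: "6 \<le> n" and "even n"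
  shows "\<exists>zs. rainbow_cycle n (2 * fact 2) zs \<and> length zs = n * ((n - 1) * fact 2)"
proof -
  let ?s = "transpose 2 (3::nat)" and ?t = "transpose 3 (4::nat)"
  have k: "2 \<le> (2::nat)" "2 + 2 \<le> n" using n by auto
  note T = swap_cycle_2
  let ?B = "tl (tile id)" and ?S = "tail [?s]"
  define G where "G = rev (tile ?t) @ [id]"
  have BS: "segs ?B ?S" by (rule segs_tiles[OF T k])
  note BS' = BS[unfolded segs_def]
  note B = tl_tile_id[of, OF order_trans[OF _ n], simplified]
  have S: "?S = rev (tile ?s) @ [id]" by (simp add: tail_def)
  \<comment> \<open>For n = 4 the swap (3, 4) would move n, and \<open>?t\<close> would not be the
    index of a tile.\<close>
  have perms: "?s permutes {2..n - 1}" "?t permutes {2..n - 1}" "id permutes {2..n - 1}"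
    using n by (auto intro!: permutes_swap_id permutes_id)
  have G: "G \<noteq> []" "hd G = ?t \<circ> lam (n - 2)" "last G = id"
    by (auto simp: G_def hd_append hd_rev last_tile)
  have "?t \<noteq> id" by (metis id_apply transpose_apply_first numeral_eq_iff num.distinct(5) semiring_norm(90))
  then have disj: "set (tile id) \<inter> set (tile ?t) = {}"
    using tile_disjoint[OF perms(3,2)] by auto
  have tile_id: "tile id = id # ?B" using n by (intro tile_id) simp
  have rot_small: "rot 1 = 2" "rot 2 = 3" "rot 3 = 4"
    using n by (simp_all add: rot_Suc)
  have swap: "rot \<circ> transpose 2 3 = transpose 3 4 \<circ> rot"
    using rot_swap[of 2] n by (simp add: eval_nat_numeral)
  have "rails ?B ?S 1 (?B @ lift 1 ([id] @ ?B)) (rev G @ lift 1 (rev (rev (tile ?s))))"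
  proof (rule rails_even[OF BS S])
    show "rev (tile ?s) \<noteq> []" "[id] \<noteq> []" "?B \<noteq> []" "G \<noteq> []" using G B by auto
    show "successively (adj n) ?B" using BS' by simp
    have "adj n ?t id" using n by (intro adjI[of 3 n 4]) auto
    then show "successively (adj n) G"
      using successively_tile[OF perms(2)]
      by (simp add: G_def successively_append_iff successively_adj_rev last_rev hd_tile del: successively_rev)
    have "distinct (tile id)" "distinct (tile ?t)" using distinct_tile perms by auto
    then show "distinct (?B @ G)"
      using disj by (subst (asm) (1 2) tile_id) (auto simp: G_def)
    show "\<pi> permutes {1..n - 1}" if "\<pi> \<in> set (?B @ G)" for \<pi>
    proof -
      have "\<pi> \<in> set (tile id) \<or> \<pi> \<in> set (tile ?t)"
        using that by (subst tile_id) (auto simp: G_def)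
      then show ?thesis using tile_permutes perms by blast
    qed
    show "length (?B @ G) = length (?B @ ?S)" by (simp add: G_def S)
    show "transpose n 1 \<circ> last ?B = rot \<circ> hd [id]" using B transpose_lam by simp
    show "transpose n 1 \<circ> hd G = rot \<circ> last (rev (tile ?s))"
      using G transpose_comp_lam[of ?t] n swap by (simp add: last_rev hd_tile)
    show "hd ?B = transpose 1 2 \<circ> last ?S" using B S lam_1 by simp
    fix a b
    have "step a b ?t id = col a b 3 4" "step a b ?s id = col a b 2 3"
      using step_transpose[of id a b 3 4] step_transpose[of id a b 2 3] by (simp_all add: step_commute)
    moreover have "step a b (rot \<circ> ?s) (rot \<circ> id) = col a b 3 4"
      using step_lift[of id a b 1 2 3] rot_small step_commute by simp
    \<comment> \<open>The colors of a tile do not depend on its index, so the two versions of copy 0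
      differ only in their swaps between tiles.\<close>
    moreover have "wt (step a b) (tile ?t) = wt (step a b) (tile ?s)"
      using wt_lift_tile[OF perms(1), of a b 0] wt_lift_tile[OF perms(2), of a b 0] by (simp add: lift_def)
    ultimately show "wt (step a b) ?B + wt (step a b) G + wt (step a b) (lift 1 (rev (tile ?s)))
        + wt (step a b) (lift 1 [id]) + col a b (rot 1) (rot 2)
      = wt (step a b) ?B + wt (step a b) ?S + wt (step a b) (lift 1 ?S)"
      unfolding S G_def rot_small
      by (simp add: wt_append wt_rev step_commute last_rev hd_rev last_lift hd_lift hd_tile)
  qed
  then show ?thesis
  proof (rule cycle_from_rails[OF T k])
    show "1 + 2 * ((n - 2) div 2) = n - 1" using even_complement \<open>even n\<close> by simp
    show "hd (?B @ lift 1 ([id] @ ?B)) = lam 1" using B by simp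
    show "hd (rev G @ lift 1 (rev (rev (tile ?s)))) = id" using G by (simp add: hd_append hd_rev)
  qed
qed

text \<open>With one tile per copy, (n, 1) leads directly from each copy to the next, and the
  rotated tiles form one cycle without any exchange.\<close>

lemma rainbow_star: "\<exists>zs. rainbow_cycle n 2 zs \<and> length zs = n * (n - 1)"
proof -
  define W where "W = tile id"
  let ?p = "\<lambda>j. concat (map (\<lambda>i. lift i W) [0..<Suc j])"
  let ?c = "\<lambda>i a b. col a b ((rot ^^ i) n) ((rot ^^ i) 1)"
  have perm: "id permutes {2..n - 1}" by (rule permutes_id)
  have W: "W \<noteq> []" "hd W = id" "last W = lam (n - 2)" "length W = n - 1" "successively (adj n) W" "distinct W"
    using successively_tile[OF perm] distinct_tile[OF perm] by (simp_all add: W_def hd_tile last_tile)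
  have W_permutes: "\<pi> permutes {1..n - 1}" if "\<pi> \<in> set W" for \<pi>
    using tile_permutes[OF perm] that by (simp add: W_def)
  have link: "transpose n 1 \<circ> last W = rot \<circ> hd W" and bij: "bij (last W)"
    using transpose_lam bij_lam by (simp_all add: W)
  have ends: "?p j \<noteq> [] \<and> hd (?p j) = id \<and> last (?p j) = (rot ^^ j) \<circ> last W" for j
  proof -
    have "[0..<Suc j] = 0 # [1..<Suc j]" by (simp add: upt_conv_Cons del: upt_Suc)
    then have "hd (?p j) = id" by (simp add: hd_lift W del: upt_Suc)
    then show ?thesis by (simp add: last_lift W del: funpow.simps)
  qed
  have joint: "adj n (last (?p j)) ((rot ^^ Suc j) \<circ> hd W)"
    "step a b (last (?p j)) ((rot ^^ Suc j) \<circ> hd W) = ?c j a b" for j a b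
    using ends adj_link[OF link] step_link[OF link bij] by (auto simp del: funpow.simps)
  have suc: "successively (adj n) (?p j)" for j
  proof (induction j)
    case 0
    show ?case using successively_lift[OF W(5)] by simp
  next
    case (Suc j)
    then show ?case
      using joint(1)[of j] successively_lift[OF W(5)]
      by (simp add: successively_append_iff hd_lift W del: funpow.simps)
  qed
  have wt: "wt (step a b) (?p j) = (\<Sum>i\<le>j. wt (step a b) (lift i W)) + (\<Sum>i<j. ?c i a b)" for j a b
  proof (induction j)
    case (Suc j)
    have "wt (step a b) (?p (Suc j)) = wt (step a b) (?p j) + ?c j a b + wt (step a b) (lift (Suc j) W)"
    proof -
      have "?p (Suc j) = ?p j @ lift (Suc j) W" by simp
      then show ?thesis
        using wt_append[of "?p j" "lift (Suc j) W" "step a b"] ends[of j] W(1) joint(2)[of a b j]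
        by (simp only: lift_simps hd_lift not_False_eq_True)
    qed
    then show ?case using Suc by simp
  qed simp
  have mem: "\<pi> \<in> Perms n \<and> (\<exists>i\<le>j. \<pi> n = (rot ^^ i) n)" if "\<pi> \<in> set (?p j)" for \<pi> j
  proof -
    obtain i \<sigma> where i: "i \<le> j" "\<sigma> \<in> set W" "\<pi> = (rot ^^ i) \<circ> \<sigma>"
      using \<open>\<pi> \<in> set (?p j)\<close> by (auto simp: set_lift less_Suc_eq_le simp del: upt_Suc)
    then show ?thesis using W_permutes[OF i(2)] lift_in_Perms lift_n by auto
  qed
  have dist: "distinct (?p j)" if "j < n" for j
    using that
  proof (induction j)
    case 0
    show ?case using distinct_lift[OF W(6)] by simp
  next
    case (Suc j)
    have "\<pi> \<notin> set (lift (Suc j) W)" if "\<pi> \<in> set (?p j)" for \<pi>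
    proof
      assume "\<pi> \<in> set (lift (Suc j) W)"
      then have "\<pi> n = (rot ^^ Suc j) n"
        using W_permutes lift_n by (auto simp: set_lift simp del: funpow.simps)
      moreover obtain i where "i \<le> j" "\<pi> n = (rot ^^ i) n" using mem[OF \<open>\<pi> \<in> set (?p j)\<close>] by blast
      ultimately show False using rot_pow_n_inj[of i "Suc j"] Suc.prems by auto
    qed
    moreover have "distinct (?p j)" using Suc by simp
    moreover have "?p (Suc j) = ?p j @ lift (Suc j) W" by simp
    ultimately show ?case using distinct_lift[OF W(6)] by (simp only: distinct_append) blast
  qed
  have len: "length (?p j) = Suc j * (n - 1)" for j
    by (induction j) (auto simp: W)
  have n_eq: "Suc (n - 1) = n" using n2 by simp
  \<comment> \<open>In this form the closing step is the instance \<open>n - 1\<close> of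
    \<open>joint\<close>.\<close>
  have head: "hd (?p j) = (rot ^^ Suc (n - 1)) \<circ> hd W" for j
    using ends unfolding n_eq rot_pow_n by (simp add: W)
  have "rainbow_cycle n 2 (?p (n - 1))"
  proof (rule rainbow_cycleI)
    have "2 * 1 \<le> n * (n - 1)" using n2 by (intro mult_le_mono) auto
    then show "2 \<le> length (?p (n - 1))" using len[of "n - 1"] n_eq by (metis mult_1_right)
    show "set (?p (n - 1)) \<subseteq> Perms n" using mem by blast
    show "distinct (?p (n - 1))" by (rule dist) (use n2 in simp)
    show "successively (adj n) (?p (n - 1))" by (rule suc)
    show "adj n (last (?p (n - 1))) (hd (?p (n - 1)))" unfolding head by (rule joint)
    fix a b assume ab: "a \<in> {1..n}" "b \<in> {1..n}" "a \<noteq> b"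
    have "wt (step a b) (?p (n - 1)) + step a b (last (?p (n - 1))) (hd (?p (n - 1)))
      = (\<Sum>i\<le>n - 1. wt (step a b) (lift i W)) + (\<Sum>i<Suc (n - 1). ?c i a b)"
      unfolding head joint wt by simp
    also have "\<dots> = wt (orbit_step a b) W + orbit_col a b n 1"
      unfolding lessThan_Suc_atMost[symmetric] n_eq wt_orbit_step orbit_col_def ..
    finally show "wt (step a b) (?p (n - 1)) + step a b (last (?p (n - 1))) (hd (?p (n - 1))) = 2"
      using wt_orbit_tile[OF ab perm] by (simp add: W_def)
  qed
  then show ?thesis using len n_eq by metis
qed

lemma rainbow_general:
  assumes "2 \<le> m" "m \<le> n" "\<not> (n = 4 \<and> m = 4)"
  shows "\<exists>zs. rainbow_cycle n (2 * fact (m - 2)) zs \<and> length zs = n * ((n - 1) * fact (m - 2))"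
proof -
  consider "m - 2 < 2" | "2 \<le> m - 2" "odd n" | "3 \<le> m - 2" "even n" | "m - 2 = 2" "even n"
    by linarith
  then show ?thesis
  proof cases
    case 1
    then have "fact (m - 2) = (1::nat)" by (auto simp: less_2_cases_iff)
    then show ?thesis using rainbow_star by simp
  next
    case 2
    obtain R where "swap_cycle (m - 2) (id # transpose 2 3 # R)"
    proof (cases "m - 2 = 2")
      case True
      then show ?thesis using swap_cycle_2 that by metis
    next
      case False
      then show ?thesis using swap_cycle_exists[of "m - 2"] 2 that by auto
    qed
    then show ?thesis using rainbow_odd 2 assms by simp
  next
    case 3
    then show ?thesis using rainbow_even assms by simp
  next
    case 4
    \<comment> \<open>Here m = 4, so n is even, at least 4, and different from 4.\<close>
    then have "6 \<le> n" using assms by presburger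
    then show ?thesis using rainbow_even_2 4 by simp
  qed
qed

end

subsection \<open>The case n = m = 4\<close>

definition word :: "nat list \<Rightarrow> nat \<Rightarrow> nat" where
  "word w x = (if x \<in> {1..length w} then w ! (x - 1) else x)"

lemma word_permutes:
  assumes "distinct w" "set w = {1..length w}"
  shows "word w permutes {1..length w}"
proof (rule bij_imp_permutes)
  have "bij_betw (\<lambda>x. x - 1) {1..length w} {..<length w}"
    by (rule bij_betw_byWitness[of _ Suc]) auto
  moreover have "bij_betw ((!) w) {..<length w} {1..length w}"
    using assms by (intro bij_betw_nth) auto
  ultimately have "bij_betw ((!) w \<circ> (\<lambda>x. x - 1)) {1..length w} {1..length w}"
    by (rule bij_betw_trans)
  then show "bij_betw (word w) {1..length w} {1..length w}"
    by (rule bij_betw_cong[THEN iffD1, rotated]) (simp add: word_def)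
qed (auto simp: word_def)

text \<open>This reduces steps between permutations to equality of lists, which can be
  evaluated.\<close>

lemma word_transpose_iff:
  assumes "length w = l" "length w' = l" "a \<in> {1..l}" "b \<in> {1..l}"
  shows "word w' = transpose a b \<circ> word w \<longleftrightarrow> w' = map (transpose a b) w"
proof
  assume eq: "word w' = transpose a b \<circ> word w"
  show "w' = map (transpose a b) w"
  proof (rule nth_equalityI)
    fix i assume "i < length w'"
    then show "w' ! i = map (transpose a b) w ! i"
      using fun_cong[OF eq, of "Suc i"] assms by (simp add: word_def)
  qed (use assms in simp)
next
  assume "w' = map (transpose a b) w"
  then show "word w' = transpose a b \<circ> word w"
    using assms by (auto simp: word_def fun_eq_iff transpose_def)
qed

lemma word_inject: "length w = length w' \<Longrightarrow> word w = word w' \<Longrightarrow> w = w'"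
proof (rule nth_equalityI)
  fix i assume "length w = length w'" "word w = word w'" "i < length w"
  moreover have "word v (Suc i) = v ! i" if "i < length v" for v
    using that by (simp add: word_def)
  ultimately show "w ! i = w' ! i" by metis
qed

definition words4 :: "nat list list" where
  "words4 =
    [[1, 2, 3, 4], [2, 1, 3, 4], [2, 3, 1, 4], [3, 2, 1, 4], [3, 1, 2, 4], [1, 3, 2, 4],
     [4, 3, 2, 1], [4, 2, 3, 1], [2, 4, 3, 1], [2, 3, 4, 1], [3, 2, 4, 1], [3, 4, 2, 1],
     [3, 4, 1, 2], [4, 3, 1, 2], [4, 1, 3, 2], [1, 4, 3, 2], [1, 3, 4, 2], [3, 1, 4, 2],
     [2, 1, 4, 3], [2, 4, 1, 3], [4, 2, 1, 3], [4, 1, 2, 3], [1, 4, 2, 3], [1, 2, 4, 3]]"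

text \<open>Appending the first word makes the closing step an ordinary one. The required count is 4
  = 2 * 2!.\<close>

lemma words4_check:
  "distinct words4"
  "list_all (\<lambda>w. distinct w \<and> length w = 4 \<and> list_all (\<lambda>x. x \<in> set w) [1, 2, 3, 4]) words4"
  "successively (\<lambda>w w'. list_ex (\<lambda>(a, b). w' = map (transpose a b) w)
     [(1, 2), (1, 3), (1, 4), (2, 3), (2, 4), (3, 4)]) (words4 @ [hd words4])"
  "list_all (\<lambda>a. list_all (\<lambda>b. a = b \<or>
     wt (\<lambda>w w'. of_bool (w' = map (transpose a b) w)) (words4 @ [hd words4]) = 4) [1, 2, 3, 4]) [1, 2, 3, 4]"
  by code_simp+

lemma rainbow_4: "\<exists>zs. rainbow_cycle 4 (2 * fact 2) zs \<and> length zs = 4 * ((4 - 1) * fact 2)"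
proof -
  let ?zs = "map word words4" and ?E = "\<lambda>w w'. list_ex (\<lambda>(a, b). w' = map (transpose a b) w)
     [(1, 2), (1, 3), (1, 4), (2, 3), (2, 4), (3, 4)]"
  have len: "length words4 = 24" and ne: "words4 \<noteq> []" by (simp_all add: words4_def)
  have w: "distinct w" "length w = 4" "set w = {1..4}" if "w \<in> set words4" for w
  proof -
    show d: "distinct w" and l: "length w = 4"
      using words4_check(2) that by (auto simp: list_all_iff)
    have "{1..4} \<subseteq> set w"
    proof
      fix x :: nat assume "x \<in> {1..4}"
      then have "x \<in> set [1, 2, 3, 4]" by auto
      then show "x \<in> set w" using words4_check(2) that unfolding list_all_iff by blast
    qed
    moreover have "card (set w) = 4" using d l by (simp add: distinct_card)
    ultimately show "set w = {1..4}" by (intro card_subset_eq[symmetric]) auto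
  qed
  have adj: "adj 4 (word w) (word w')" if "w \<in> set words4" "w' \<in> set words4" "?E w w'" for w w'
  proof -
    obtain a b where "(a, b) \<in> set [(1, 2), (1, 3), (1, 4), (2, 3), (2, 4), (3, 4)]"
      "w' = map (transpose a b) w"
      using \<open>?E w w'\<close> unfolding list_ex_iff by blast
    then have "a \<in> {1..4}" "b \<in> {1..4}" "a \<noteq> b" "w' = map (transpose a b) w" by auto
    then show ?thesis using w that word_transpose_iff[of w 4 w' a b] by (intro adjI) auto
  qed
  have suc: "successively ?E words4" "?E (last words4) (hd words4)"
    using words4_check(3) ne by (simp_all only: successively_append_iff) auto
  have step: "step a b (word w) (word w') = of_bool (w' = map (transpose a b) w)"
    if "a \<in> {1..4}" "b \<in> {1..4}" "w \<in> set words4" "w' \<in> set words4" for a b w w'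
    using that w word_transpose_iff[of w 4 w' a b] by (simp add: step_def)
  have wt_cong: "wt f xs = wt g xs" if "\<And>x y. x \<in> set xs \<Longrightarrow> y \<in> set xs \<Longrightarrow> f x y = g x y"
    for f g :: "nat list \<Rightarrow> nat list \<Rightarrow> nat" and xs
    using that by (simp add: wt_nth)
  have "rainbow_cycle 4 4 ?zs"
  proof (rule rainbow_cycleI)
    show "2 \<le> length ?zs" using len by simp
    show "set ?zs \<subseteq> Perms 4"
      using w word_permutes by (force simp: Perms_def)
    show "distinct ?zs"
      using words4_check(1) w word_inject by (fastforce simp: distinct_map inj_on_def)
    show "successively (adj 4) ?zs"
      unfolding successively_map by (rule successively_mono[OF suc(1)]) (rule adj)
    show "adj 4 (last ?zs) (hd ?zs)"
      using adj[OF _ _ suc(2)] ne by (simp add: last_map hd_map)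
    fix a b :: nat assume ab: "a \<in> {1..4}" "b \<in> {1..4}" "a \<noteq> b"
    let ?g = "\<lambda>w w'. of_bool (w' = map (transpose a b) w) :: nat"
    have "wt (step a b) ?zs + step a b (last ?zs) (hd ?zs) = wt ?g words4 + ?g (last words4) (hd words4)"
      using ne step[OF ab(1,2)] by (simp add: wt_map last_map hd_map cong: wt_cong)
    also have "\<dots> = wt ?g (words4 @ [hd words4])"
      using ne by (simp add: wt_append)
    also have "\<dots> = 4"
    proof -
      have "a \<in> set [1, 2, 3, 4]" "b \<in> set [1, 2, 3, 4]" using ab by auto
      then show ?thesis using words4_check(4) ab(3) unfolding list_all_iff by blast
    qed
    finally show "wt (step a b) ?zs + step a b (last ?zs) (hd ?zs) = 4" .
  qed
  then show ?thesis using len by (intro exI[of _ ?zs]) (simp add: fact_numeral)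
qed

section \<open>All cases together, and the balanced Gray code\<close>

lemma rainbow_cycle_exists:
  assumes "2 \<le> m" "m \<le> n"
  shows "\<exists>zs. rainbow_cycle n (2 * fact (m - 2)) zs \<and> length zs = n * ((n - 1) * fact (m - 2))"
proof (cases "n = 4 \<and> m = 4")
  case True
  then show ?thesis using rainbow_4 by simp
next
  case False
  interpret gray n using assms by unfold_locales simp
  show ?thesis using rainbow_general assms False by blast
qed

theorem theorem2p2:
  fixes n m :: nat
  assumes "2 \<le> n" and "2 \<le> m" and "m \<le> n"
  shows "(\<exists>xs. rainbow_cycle n (2 * fact (m - 2)) xs) \<and>
         (\<exists>xs. balanced_transposition_gray_code n xs)"
proof
  show "\<exists>xs. rainbow_cycle n (2 * fact (m - 2)) xs"
    using rainbow_cycle_exists assms by blast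
  obtain zs where zs: "rainbow_cycle n (2 * fact (n - 2)) zs" "length zs = n * ((n - 1) * fact (n - 2))"
    using rainbow_cycle_exists[of n n] assms by auto
  have "n * ((n - 1) * fact (n - 2)) = fact n"
  proof -
    obtain l where "n = Suc (Suc l)" using assms(1) by (metis add_2_eq_Suc le_Suc_ex)
    then show ?thesis by simp
  qed
  then have len: "length zs = fact n" using zs by simp
  have "card (Perms n) = fact n"
    using card_permutations[of "{1..n}" n] by (simp add: Perms_def)
  moreover have "finite (Perms n)" by (simp add: Perms_def finite_permutations)
  \<comment> \<open>The lengths were carried along for this: \<open>fact n\<close> distinct elements
    exhaust \<open>Perms n\<close>.\<close>
  ultimately have "set zs = Perms n"
    using zs len by (intro card_subset_eq) (auto simp: rainbow_cycle_def distinct_card)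
  then show "\<exists>xs. balanced_transposition_gray_code n xs"
    using zs len by (auto simp: balanced_transposition_gray_code_def rainbow_cycle_def)
qed

end
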